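(* Let $\alpha,\lambda\in(0,\infty)$ and $\beta\in(0,1)$, and let $g$ be the (continuous) density of the one-sided tempered stable distribution $\eta=\mathrm{TS}(\alpha,\beta,\lambda)$. Then $$g(x)\sim\alpha\exp\big(-\alpha\,\Gamma(-\beta)\,\lambda^\beta\big)\frac{e^{-\lambda x}}{x^{1+\beta}}\quad\text{as }x\to\infty.$$
   Context: For $\alpha,\lambda\in(0,\infty)$ and $\beta\in[0,1)$, the one-sided tempered stable distribution $\mathrm{TS}(\alpha,\beta,\lambda)$ is the infinitely divisible distribution on $\mathbb{R}$ with characteristic function $\varphi(z)=\exp\big(\int_{\mathbb{R}}(e^{izx}-1)F(dx)\big)$, $z\in\mathbb{R}$, where $F(dx)=\frac{\alpha}{x^{1+\beta}}e^{-\lambda x}\mathbf{1}_{(0,\infty)}(x)\,dx$. For $\beta\in(0,1)$ it is absolutely continuous with a density $g$ of class $C^\infty(\mathbb{R})$. The notation $a(x)\sim b(x)$ means that $a(x)/b(x)\to1$ in the indicated limit. $\Gamma:\mathbb{R}\setminus\{0,-1,-2,\ldots\}\to\mathbb{R}$ is the Gamma function. *)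

theory Defs
  imports "HOL-Probability.Probability"
begin

text \<open>For every \<open>n \<ge> 1\<close> the distribution is an \<open>n\<close>-fold convolution power; \<open>return borel 0\<close> (the
  Dirac measure at 0) is the neutral element of convolution.\<close>

definition infinitely_divisible :: "real measure \<Rightarrow> bool" where
  "infinitely_divisible \<eta> \<longleftrightarrow>
     (\<forall>n\<ge>1. \<exists>\<nu>. real_distribution \<nu> \<and> \<eta> = (convolution \<nu> ^^ n) (return borel 0))"

definition TS_Levy_measure :: "real \<Rightarrow> real \<Rightarrow> real \<Rightarrow> real measure" where
  "TS_Levy_measure \<alpha> \<beta> l =
     density lborel
       (\<lambda>x. ennreal (\<alpha> / x powr (1 + \<beta>) * exp (- l * x) * indicator {0<..} x))"

text \<open>\<open>is_TS \<alpha> \<beta> l \<eta>\<close> says \<open>\<eta> = TS(\<alpha>, \<beta>, l)\<close>, for \<open>\<alpha>, l > 0\<close> and \<open>0 \<le> \<beta> < 1\<close>. In this range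
  \<open>\<integral> min(1, x) F(dx)\<close> is finite, so the integrand of the exponent is integrable. The
  characteristic function determines the distribution, as the lemma below records.\<close>

definition is_TS :: "real \<Rightarrow> real \<Rightarrow> real \<Rightarrow> real measure \<Rightarrow> bool" where
  "is_TS \<alpha> \<beta> l \<eta> \<longleftrightarrow>
     real_distribution \<eta> \<and> infinitely_divisible \<eta> \<and>
     (\<forall>z. char \<eta> z = exp (CLINT x|TS_Levy_measure \<alpha> \<beta> l. iexp (z * x) - 1))"

lemma is_TS_unique: "is_TS \<alpha> \<beta> l \<eta> \<Longrightarrow> is_TS \<alpha> \<beta> l \<eta>' \<Longrightarrow> \<eta> = \<eta>'"
  unfolding is_TS_def by (intro Levy_uniqueness ext) simp_all

text \<open>The requirement \<open>0 \<le> g x\<close> is needed since \<open>ennreal\<close> truncates negative values to 0.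
  Continuity singles out one version of the density.\<close>

definition is_continuous_density :: "real measure \<Rightarrow> (real \<Rightarrow> real) \<Rightarrow> bool" where
  "is_continuous_density \<eta> g \<longleftrightarrow>
     continuous_on UNIV g \<and> (\<forall>x. 0 \<le> g x) \<and> \<eta> = density lborel (\<lambda>x. ennreal (g x))"

end

theory Submission
  imports Defs
begin

text \<open>Differentiating the characteristic function shows that \<open>x \<eta>(dx)\<close> is the convolution of \<open>\<eta>\<close> with
  \<open>x F(dx)\<close>. For the density this gives \<open>g = 0\<close> on the negative half-line, and for the tilted density
  \<open>f x = exp (l x) g x\<close> the Volterra equation \<open>x f x = \<alpha> \<integral> y\<^sup>-\<^sup>\<beta> f (x - y) dy\<close> over \<open>y > 0\<close>. The equation turns
  into a differential (in)equality for the Laplace transform of \<open>f\<close> (truncated or not), whence \<open>f\<close> is integrable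
  with integral \<open>M = exp (- \<alpha> \<Gamma>(-\<beta>) l\<^sup>\<beta>)\<close>. Finally the equation itself bootstraps to
  \<open>f x = O(x powr - (1 + \<beta>))\<close>, so that in it only the \<open>y > x/2\<close> matter as \<open>x \<rightarrow> \<infinity>\<close>, and these
  contribute \<open>\<alpha> M / x\<^sup>\<beta>\<close>.\<close>

section \<open>Gamma integrals and characteristic functions\<close>

text \<open>Tilting by \<open>exp (l * x)\<close> strips the exponential off the kernel and leaves a
  pure power, whose Laplace transform is K(p) = \<alpha> \<Gamma>(1 - \<beta>) p^(\<beta> - 1). The
  equation for the Laplace transform L of \<open>f\<close> is then L' = - K L, so L(p) is a multiple
  of exp (- c p^\<beta>) with c = \<alpha> \<Gamma>(1 - \<beta>) / \<beta> = - \<alpha>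
  \<Gamma>(-\<beta>). Since \<open>g\<close> has mass 1, L(l) = 1, and this fixes L(0) = exp (c
  l^\<beta>) = M. The obstacle is that L(p) is a priori known to be finite only for p \<ge> l,
  whereas M is its value at 0; truncation bridges the gap at the price of an inequality. Likewise,
  differentiating the characteristic function requires a first moment of \<eta>, which is not given
  and has to be extracted from the behaviour of that function at 0. The bootstrap works because the
  terms with y \<le> x/2 have order x^(1 - \<beta>) times f near x, smaller by a factor x^(-
  \<beta>) than the left-hand side x f(x), which can therefore absorb them.\<close>

lemma has_bochner_integral_powr_exp:
  fixes a p :: real
  assumes "0 < a" "0 < p"
  shows "has_bochner_integral lborel (\<lambda>y. y powr (a - 1) * exp (- p * y) * indicator {0<..} y)
           (Gamma a / p powr a)"
proof (rule has_bochner_integral_nn_integral)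
  have "ennreal (Gamma a) = (\<integral>\<^sup>+t. ennreal (indicator {0..} t * t powr (a - 1) / exp t) \<partial>lborel)"
    by (rule Gamma_conv_nn_integral_real[OF assms(1)])
  also have "\<dots> = ennreal p * (\<integral>\<^sup>+t. ennreal (indicator {0..} (0 + p * t) * (0 + p * t) powr (a - 1) / exp (0 + p * t)) \<partial>lborel)"
    using assms by (subst nn_integral_real_affine[where c = p and t = 0]) auto
  \<comment> \<open>The two indicators differ at 0, but there \<open>0 powr (a - 1) = 0\<close> by
    convention, even for a = 1.\<close>
  also have "(\<lambda>t. indicator {0..} (0 + p * t) * (0 + p * t) powr (a - 1) / exp (0 + p * t)) =
      (\<lambda>t. p powr (a - 1) * (t powr (a - 1) * exp (- p * t) * indicator {0<..} t))"
    using assms by (auto simp: fun_eq_iff indicator_def powr_mult zero_le_mult_iff exp_minus field_simps)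
  also have "ennreal p * (\<integral>\<^sup>+t. ennreal (p powr (a - 1) * (t powr (a - 1) * exp (- p * t) * indicator {0<..} t)) \<partial>lborel)
      = ennreal (p powr a) * (\<integral>\<^sup>+t. ennreal (t powr (a - 1) * exp (- p * t) * indicator {0<..} t) \<partial>lborel)"
  proof -
    have "(\<integral>\<^sup>+t. ennreal (p powr (a - 1) * (t powr (a - 1) * exp (- p * t) * indicator {0<..} t)) \<partial>lborel)
      = ennreal (p powr (a - 1)) * (\<integral>\<^sup>+t. ennreal (t powr (a - 1) * exp (- p * t) * indicator {0<..} t) \<partial>lborel)"
      by (subst ennreal_mult') (auto intro!: nn_integral_cmult)
    moreover have "p powr a = p * p powr (a - 1)"
      using assms by (simp add: powr_diff)
    ultimately show ?thesis
      using assms by (simp add: ennreal_mult' mult.assoc)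
  qed
  finally have *: "ennreal (Gamma a) = ennreal (p powr a) * (\<integral>\<^sup>+t. ennreal (t powr (a - 1) * exp (- p * t) * indicator {0<..} t) \<partial>lborel)" .
  have "(\<integral>\<^sup>+t. ennreal (t powr (a - 1) * exp (- p * t) * indicator {0<..} t) \<partial>lborel)
      = ennreal (1 / p powr a) * (ennreal (p powr a) * (\<integral>\<^sup>+t. ennreal (t powr (a - 1) * exp (- p * t) * indicator {0<..} t) \<partial>lborel))"
    using assms by (simp add: mult.assoc[symmetric] flip: ennreal_mult)
  also have "\<dots> = ennreal (Gamma a / p powr a)"
    using assms by (subst *[symmetric]) (simp flip: ennreal_mult)
  finally show "(\<integral>\<^sup>+t. ennreal (t powr (a - 1) * exp (- p * t) * indicator {0<..} t) \<partial>lborel) = ennreal (Gamma a / p powr a)" .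
qed (use assms Gamma_real_pos[of a] in \<open>auto intro!: divide_nonneg_nonneg less_imp_le\<close>)

section \<open>Characteristic functions: difference quotients, moments, uniqueness\<close>

lemma norm_iexp_minus_one_le: "norm (iexp x - 1) \<le> \<bar>x\<bar>"
  using iexp_approx1[of x 0] by simp

text \<open>Chain rule for \<open>exp\<close> along the step sizes 1/(n+1), because (exp d - 1) / d
  tends to 1. It serves twice: for the integrand \<open>iexp\<close> and for the exponent of the
  characteristic function.\<close>

lemma LIMSEQ_cexp_difference_quotient:
  fixes a :: complex
  assumes "(\<lambda>n. of_real (real (Suc n)) * d n) \<longlonglongrightarrow> a"
  shows "(\<lambda>n. of_real (real (Suc n)) * (exp (d n) - 1)) \<longlonglongrightarrow> a"
proof -
  have "(\<lambda>n. of_real (inverse (real (Suc n))) * (of_real (real (Suc n)) * d n)) \<longlonglongrightarrow> of_real 0 * a"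
    by (intro tendsto_intros LIMSEQ_inverse_real_of_nat assms)
  then have d0: "d \<longlonglongrightarrow> 0"
    by (simp add: field_simps del: of_nat_Suc)
  \<comment> \<open>\<open>q\<close> fills the removable singularity of (exp w - 1) / w, so steps
    with \<open>d n = 0\<close> need no separate treatment.\<close>
  define q :: "complex \<Rightarrow> complex" where "q = (\<lambda>w. if w = 0 then 1 else (exp w - 1) / w)"
  have "((\<lambda>w. (exp w - 1) / w) \<longlongrightarrow> 1) (at (0::complex))"
    using DERIV_exp[of "0::complex"] by (simp add: DERIV_def)
  then have "(q \<longlongrightarrow> 1) (at 0)"
    by (rule Lim_transform_eventually) (auto simp: q_def eventually_at_filter)
  then have "isCont q 0"
    by (simp add: isCont_def q_def)
  from isCont_tendsto_compose[OF this d0] have "(\<lambda>n. q (d n)) \<longlonglongrightarrow> 1"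
    by (simp add: q_def)
  from tendsto_mult[OF this assms] have "(\<lambda>n. q (d n) * (of_real (real (Suc n)) * d n)) \<longlonglongrightarrow> a"
    by simp
  moreover have "q (d n) * (of_real (real (Suc n)) * d n) = of_real (real (Suc n)) * (exp (d n) - 1)" for n
    by (simp add: q_def)
  ultimately show ?thesis by (simp only:)
qed

text \<open>Dominated convergence with majorant |x|, from |exp(it) - 1| \<le> |t|. One sequence of
  steps is enough, since later only two limits of the same sequence are compared.\<close>

lemma LIMSEQ_integral_iexp_difference_quotient:
  fixes M :: "real measure"
  assumes int: "integrable M (\<lambda>x. x)" and [measurable_cong]: "sets M = sets borel"
  shows "(\<lambda>n. \<integral>x. real (Suc n) * (iexp ((z + inverse (real (Suc n))) * x) - iexp (z * x)) \<partial>M)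
           \<longlonglongrightarrow> (\<integral>x. \<i> * x * iexp (z * x) \<partial>M)"
proof (rule integral_dominated_convergence)
  have eq: "real (Suc n) * (iexp ((z + inverse (real (Suc n))) * x) - iexp (z * x))
      = iexp (z * x) * (real (Suc n) * (iexp (inverse (real (Suc n)) * x) - 1))" for n and x :: real
    by (simp add: algebra_simps flip: exp_add)
  show "AE x in M. (\<lambda>n. real (Suc n) * (iexp ((z + inverse (real (Suc n))) * x) - iexp (z * x))) \<longlonglongrightarrow> \<i> * x * iexp (z * x)"
  proof (rule AE_I2)
    fix x :: real
    have "(\<lambda>n. real (Suc n) * (iexp (inverse (real (Suc n)) * x) - 1)) \<longlonglongrightarrow> \<i> * x"
      by (rule LIMSEQ_cexp_difference_quotient) (simp add: field_simps del: of_nat_Suc)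
    then show "(\<lambda>n. real (Suc n) * (iexp ((z + inverse (real (Suc n))) * x) - iexp (z * x))) \<longlonglongrightarrow> \<i> * x * iexp (z * x)"
      unfolding eq mult.commute[of "\<i> * x"] by (rule tendsto_mult_left)
  qed
  show "AE x in M. norm (real (Suc n) * (iexp ((z + inverse (real (Suc n))) * x) - iexp (z * x))) \<le> \<bar>x\<bar>" for n
  proof (rule AE_I2)
    fix x :: real
    have "norm (iexp (inverse (real (Suc n)) * x) - 1) \<le> inverse (real (Suc n)) * \<bar>x\<bar>"
      using norm_iexp_minus_one_le[of "inverse (real (Suc n)) * x"] by (simp add: abs_mult)
    then have "real (Suc n) * norm (iexp (inverse (real (Suc n)) * x) - 1) \<le> real (Suc n) * (inverse (real (Suc n)) * \<bar>x\<bar>)"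
      by (intro mult_left_mono) auto
    also have "\<dots> = \<bar>x\<bar>" by (simp del: of_nat_Suc)
    finally show "norm (real (Suc n) * (iexp ((z + inverse (real (Suc n))) * x) - iexp (z * x))) \<le> \<bar>x\<bar>"
      unfolding eq norm_mult by (simp add: norm_mult del: of_nat_Suc)
  qed
  show "integrable M (\<lambda>x. \<bar>x\<bar>)"
    using int by simp
qed (auto simp: int)

text \<open>The functions 2 (1 - cos(hx)) / h^2 tend to x^2 as h tends to 0, and their integrals
  stay below 2C. Fatou gives a finite second moment, hence a first one.\<close>

lemma (in real_distribution) integrable_if_char_quadratic:
  assumes C: "\<And>z. 1 - Re (char M z) \<le> C * z\<^sup>2"
  shows "integrable M (\<lambda>x. x)"
proof -
  define h where "h n = inverse (real (Suc n))" for n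
  have h: "h n > 0" for n by (simp add: h_def)
  have lim: "(\<lambda>n. 2 * (1 - cos (h n * x)) / (h n)\<^sup>2) \<longlonglongrightarrow> x\<^sup>2" for x :: real
  proof -
    \<comment> \<open>This is the derivative of sin(t x/2) at t = 0; it enters through 1 - cos(hx) =
      2 sin(hx/2)^2.\<close>
    have "((\<lambda>t. sin (t * (x/2)) / t) \<longlongrightarrow> x / 2) (at 0)"
      using DERIV_fun_sin[OF DERIV_cmult_Id[of "x/2" "0::real" UNIV]]
      by (simp add: DERIV_def mult.commute)
    moreover have "filterlim h (at 0) sequentially"
      unfolding filterlim_at h_def using LIMSEQ_inverse_real_of_nat by auto
    ultimately have "(\<lambda>n. sin (h n * (x/2)) / h n) \<longlonglongrightarrow> x / 2"
      by (rule filterlim_compose)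
    from tendsto_mult[OF tendsto_const[of 4] tendsto_power[OF this, of 2]]
    have "(\<lambda>n. 4 * (sin (h n * (x/2)) / h n)\<^sup>2) \<longlonglongrightarrow> x\<^sup>2"
      by (simp add: power2_eq_square)
    moreover have "4 * (sin (h n * (x/2)) / h n)\<^sup>2 = 2 * (1 - cos (h n * x)) / (h n)\<^sup>2" for n
      using cos_double_sin[of "h n * (x/2)"] by (simp add: power_divide)
    ultimately show ?thesis by simp
  qed
  have intcos: "integrable M (\<lambda>x. cos (z * x))" for z
    by (rule integrable_const_bound[of _ 1]) auto
  have rechar: "Re (char M z) = (\<integral>x. cos (z * x) \<partial>M)" for z
  proof -
    have "integrable M (\<lambda>x. iexp (z * x))"
      by (rule integrable_iexp) auto
    then have "Re (char M z) = (\<integral>x. Re (iexp (z * x)) \<partial>M)"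
      unfolding char_def by simp
    then show ?thesis by (simp add: Re_exp)
  qed
  have bound: "(\<integral>\<^sup>+x. ennreal (2 * (1 - cos (h n * x)) / (h n)\<^sup>2) \<partial>M) \<le> ennreal (2 * C)" for n
  proof -
    have "(\<integral>\<^sup>+x. ennreal (2 * (1 - cos (h n * x)) / (h n)\<^sup>2) \<partial>M) = ennreal (\<integral>x. 2 * (1 - cos (h n * x)) / (h n)\<^sup>2 \<partial>M)"
      using intcos by (intro nn_integral_eq_integral) auto
    also have "(\<integral>x. 2 * (1 - cos (h n * x)) / (h n)\<^sup>2 \<partial>M) = 2 * (1 - Re (char M (h n))) / (h n)\<^sup>2"
      using intcos by (simp add: rechar prob_space del: space_eq_univ)
    also have "ennreal \<dots> \<le> ennreal (2 * C)"
      using C[of "h n"] h[of n] by (intro ennreal_leI) (simp add: divide_le_eq)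
    finally show ?thesis .
  qed
  have "(\<integral>\<^sup>+x. ennreal (x\<^sup>2) \<partial>M) = (\<integral>\<^sup>+x. liminf (\<lambda>n. ennreal (2 * (1 - cos (h n * x)) / (h n)\<^sup>2)) \<partial>M)"
  proof (intro nn_integral_cong)
    fix x :: real
    have "(\<lambda>n. ennreal (2 * (1 - cos (h n * x)) / (h n)\<^sup>2)) \<longlonglongrightarrow> ennreal (x\<^sup>2)"
      by (intro tendsto_ennrealI lim)
    from lim_imp_Liminf[OF _ this] show "ennreal (x\<^sup>2) = liminf (\<lambda>n. ennreal (2 * (1 - cos (h n * x)) / (h n)\<^sup>2))"
      by simp
  qed
  also have "\<dots> \<le> liminf (\<lambda>n. \<integral>\<^sup>+x. ennreal (2 * (1 - cos (h n * x)) / (h n)\<^sup>2) \<partial>M)"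
    by (intro nn_integral_liminf) auto
  also have "\<dots> \<le> ennreal (2 * C)"
    by (rule Liminf_le) (use bound in \<open>auto simp del: ennreal_mult intro!: always_eventually\<close>)
  finally have "(\<integral>\<^sup>+x. ennreal (x\<^sup>2) \<partial>M) < \<infinity>"
    using ennreal_less_top le_less_trans infinity_ennreal_def by metis
  then have sq: "integrable M (\<lambda>x. x\<^sup>2)"
    by (intro integrableI_nonneg) auto
  show ?thesis
  proof (rule Bochner_Integration.integrable_bound)
    show "integrable M (\<lambda>x. 1 + x\<^sup>2)" using sq by simp
    show "AE x in M. norm x \<le> norm (1 + x\<^sup>2)"
    proof (rule AE_I2)
      fix x :: real
      have "0 \<le> (1 - \<bar>x\<bar>)\<^sup>2" by simp
      then have "2 * \<bar>x\<bar> \<le> 1 + x\<^sup>2" by (simp add: power2_diff)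
      then show "norm x \<le> norm (1 + x\<^sup>2)" by (simp add: abs_of_nonneg)
    qed
  qed auto
qed

text \<open>Levy's uniqueness theorem concerns probability measures, so both functions are divided
  by their integral \<open>m\<close>, which they share by the case z = 0. Nonnegativity makes the
  quotients densities.\<close>

lemma AE_eq_if_Fourier_eq:
  fixes u v :: "real \<Rightarrow> real"
  assumes u: "integrable lborel u" "\<And>x. 0 \<le> u x" and v: "integrable lborel v" "\<And>x. 0 \<le> v x"
    and eq: "\<And>z. (CLINT x|lborel. u x * iexp (z * x)) = (CLINT x|lborel. v x * iexp (z * x))"
  shows "AE x in lborel. u x = v x"
proof -
  have [measurable]: "u \<in> borel_measurable borel" "v \<in> borel_measurable borel"
    using u(1) v(1) by auto
  define m where "m = (\<integral>x. u x \<partial>lborel)"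
  have "complex_of_real (\<integral>x. u x \<partial>lborel) = complex_of_real (\<integral>x. v x \<partial>lborel)"
    using eq[of 0] by simp
  then have mv: "m = (\<integral>x. v x \<partial>lborel)"
    by (simp add: m_def)
  show ?thesis
  proof (cases "m = 0")
    case True
    have "AE x in lborel. u x = 0"
      using integral_nonneg_eq_0_iff_AE[OF u(1)] u(2) True m_def by auto
    moreover have "AE x in lborel. v x = 0"
      using integral_nonneg_eq_0_iff_AE[OF v(1)] v(2) True mv by auto
    ultimately show ?thesis by eventually_elim simp
  next
    case False
    have m: "m > 0"
      using False u(2) by (simp add: m_def order_less_le)
    have *: "real_distribution (density lborel (\<lambda>x. ennreal (w x / m)))
           \<and> char (density lborel (\<lambda>x. ennreal (w x / m))) = (\<lambda>z. (CLINT x|lborel. w x * iexp (z * x)) / m)"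
      if w: "integrable lborel w" "\<And>x. 0 \<le> w x" "m = (\<integral>x. w x \<partial>lborel)" for w
    proof (intro conjI ext)
      have [measurable]: "w \<in> borel_measurable borel" using w(1) by auto
      have "prob_space (density lborel (\<lambda>x. ennreal (w x / m)))"
      proof (rule prob_spaceI)
        have "emeasure (density lborel (\<lambda>x. ennreal (w x / m))) (space (density lborel (\<lambda>x. ennreal (w x / m))))
            = (\<integral>\<^sup>+x. ennreal (w x / m) \<partial>lborel)"
          by (subst emeasure_density) auto
        also have "\<dots> = ennreal (\<integral>x. w x / m \<partial>lborel)"
          using w m by (intro nn_integral_eq_integral) auto
        also have "\<dots> = 1" using m w(3) by simp
        finally show "emeasure (density lborel (\<lambda>x. ennreal (w x / m))) (space (density lborel (\<lambda>x. ennreal (w x / m)))) = 1" .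
      qed
      then show "real_distribution (density lborel (\<lambda>x. ennreal (w x / m)))"
        by (simp add: real_distribution_def real_distribution_axioms_def)
      fix z
      have "char (density lborel (\<lambda>x. ennreal (w x / m))) z = (CLINT x|lborel. (w x / m) *\<^sub>R iexp (z * x))"
        unfolding char_def using w m by (subst integral_density) auto
      also have "\<dots> = (CLINT x|lborel. (w x * iexp (z * x)) / m)"
        by (simp add: scaleR_conv_of_real)
      also have "\<dots> = (CLINT x|lborel. w x * iexp (z * x)) / m"
        by (rule integral_divide_zero)
      finally show "char (density lborel (\<lambda>x. ennreal (w x / m))) z = (CLINT x|lborel. w x * iexp (z * x)) / m" .
    qed
    have "density lborel (\<lambda>x. ennreal (u x / m)) = density lborel (\<lambda>x. ennreal (v x / m))"
      using *[OF u m_def] *[OF v mv] eq by (intro Levy_uniqueness) auto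
    then have "AE x in lborel. ennreal (u x / m) = ennreal (v x / m)"
      by (intro sigma_finite_measure.density_unique[OF lborel.sigma_finite_measure_axioms]) auto
    then show ?thesis
      using m u(2) v(2) by (elim eventually_mono) (simp add: divide_nonneg_pos)
  qed
qed

section \<open>Convolutions on the line and their Fourier transforms\<close>

text \<open>The factor \<open>iexp (z * x)\<close> of modulus 1 is included so that one statement
  serves both the Fourier transform and, at z = 0, the convolution itself.\<close>

lemma integrable_convolution_kernel:
  fixes k g :: "real \<Rightarrow> real"
  assumes k: "integrable lborel k" and g: "integrable lborel g"
  shows "integrable (lborel \<Otimes>\<^sub>M lborel) (\<lambda>(y, x). k y * g (x - y) * iexp (z * x))"
proof -
  have [measurable]: "k \<in> borel_measurable borel" "g \<in> borel_measurable borel"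
    using k g by auto
  have shift: "(\<integral>x. \<bar>g (x - y)\<bar> \<partial>lborel) = (\<integral>x. \<bar>g x\<bar> \<partial>lborel)" for y
    using lborel_integral_real_affine[of 1 "\<lambda>x. \<bar>g x\<bar>" "-y"] by simp
  have ishift: "integrable lborel (\<lambda>x. g (x - y))" for y
    using lborel_integrable_real_affine[OF g, of 1 "-y"] by simp
  show ?thesis
  proof (rule lborel_pair.Fubini_integrable)
    show "integrable lborel (\<lambda>y. \<integral>x. norm (case (y, x) of (y, x) \<Rightarrow> k y * g (x - y) * iexp (z * x)) \<partial>lborel)"
      using k by (simp add: norm_mult abs_mult shift)
    show "AE y in lborel. integrable lborel (\<lambda>x. case (y, x) of (y, x) \<Rightarrow> k y * g (x - y) * iexp (z * x))"
    proof (rule AE_I2)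
      fix y :: real
      have "integrable lborel (\<lambda>x. k y * g (x - y))"
        using ishift by simp
      then show "integrable lborel (\<lambda>x. case (y, x) of (y, x) \<Rightarrow> k y * g (x - y) * iexp (z * x))"
        by (rule Bochner_Integration.integrable_bound) (auto simp: norm_mult)
    qed
  qed measurable
qed

lemma
  fixes k g :: "real \<Rightarrow> real"
  assumes k: "integrable lborel k" and g: "integrable lborel g"
  shows integrable_convolution: "integrable lborel (\<lambda>x. \<integral>y. k y * g (x - y) \<partial>lborel)"
    and Fourier_convolution: "(CLINT x|lborel. (\<integral>y. k y * g (x - y) \<partial>lborel) * iexp (z * x))
      = (CLINT x|lborel. g x * iexp (z * x)) * (CLINT y|lborel. k y * iexp (z * y))"
proof -
  have "integrable lborel (\<lambda>x. CLINT y|lborel. k y * g (x - y) * iexp (0 * x))"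
    by (intro lborel_pair.integrable_snd integrable_convolution_kernel k g)
  then have "integrable lborel (\<lambda>x. complex_of_real (\<integral>y. k y * g (x - y) \<partial>lborel))"
    by (simp flip: of_real_mult)
  then show "integrable lborel (\<lambda>x. \<integral>y. k y * g (x - y) \<partial>lborel)"
    by (simp only: complex_of_real_integrable_eq)
  have eq: "CLBINT x. k y * g (x - y) * iexp (z * x) = k y * iexp (z * y) * (CLINT x|lborel. g x * iexp (z * x))" for y
  proof -
    have "CLBINT x. k y * g (x - y) * iexp (z * x) = CLBINT x. k y * g x * iexp (z * (y + x))"
      by (subst lborel_integral_real_affine[where c = 1 and t = y]) auto
    also have "\<dots> = CLBINT x. (k y * iexp (z * y)) * (g x * iexp (z * x))"
      by (simp add: algebra_simps exp_add)
    finally show ?thesis by simp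
  qed
  have "(CLINT x|lborel. (\<integral>y. k y * g (x - y) \<partial>lborel) * iexp (z * x)) =
      (CLINT x|lborel. (CLINT y|lborel. k y * g (x - y) * iexp (z * x)))"
    by (simp flip: of_real_mult)
  also have "\<dots> = (CLINT y|lborel. (CLINT x|lborel. k y * g (x - y) * iexp (z * x)))"
    by (intro lborel_pair.Fubini_integral integrable_convolution_kernel k g)
  also have "\<dots> = (CLINT x|lborel. g x * iexp (z * x)) * (CLINT y|lborel. k y * iexp (z * y))"
    by (subst eq) (simp only: integral_mult_left_zero mult.commute)
  finally show "(CLINT x|lborel. (\<integral>y. k y * g (x - y) \<partial>lborel) * iexp (z * x))
      = (CLINT x|lborel. g x * iexp (z * x)) * (CLINT y|lborel. k y * iexp (z * y))" .
qed

section \<open>The size-bias identity\<close>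

lemma one_minus_half_square_le_cos: "1 - x\<^sup>2 / 2 \<le> cos (x :: real)"
proof -
  have "(sin (x / 2))\<^sup>2 \<le> (x / 2)\<^sup>2"
    using abs_sin_x_le_abs_x[of "x / 2"] by (simp add: abs_le_square_iff[symmetric])
  then show ?thesis
    using cos_double_sin[of "x / 2"] by (simp add: power_divide)
qed

text \<open>Split 1 - e^a cos b as (1 - e^a) + e^a (1 - cos b), where e^a \<le> 1 because a \<le>
  0.\<close>

lemma one_minus_Re_exp_le:
  fixes w :: complex
  assumes "Re w \<le> 0"
  shows "1 - Re (exp w) \<le> - Re w + (Im w)\<^sup>2 / 2"
proof -
  have "1 - cos (Im w) \<le> (Im w)\<^sup>2 / 2"
    using one_minus_half_square_le_cos[of "Im w"] by simp
  moreover have "exp (Re w) * (1 - cos (Im w)) \<le> 1 * (1 - cos (Im w))"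
    using assms by (intro mult_right_mono) auto
  moreover have "1 + Re w \<le> exp (Re w)"
    by (rule exp_ge_add_one_self)
  ultimately show ?thesis
    by (simp add: Re_exp algebra_simps del: exp_ge_add_one_self)
qed

text \<open>The derivative of exp \<psi> is \<psi>' exp \<psi>. Up to the factor i, the left side is
  the Fourier transform of x g(x) and \<psi>' is that of x w(x), so x g(x) and the convolution of x
  w(x) with g have the same transform.\<close>

lemma size_bias_identity:
  fixes w g :: "real \<Rightarrow> real"
  assumes w[measurable]: "w \<in> borel_measurable borel" and w0: "\<And>x. 0 \<le> w x" "\<And>x. x < 0 \<Longrightarrow> w x = 0"
    and w1: "integrable lborel (\<lambda>x. x * w x)" and w2: "integrable lborel (\<lambda>x. x\<^sup>2 * w x)"
    and g[measurable]: "g \<in> borel_measurable borel" and g0: "\<And>x. 0 \<le> g x"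
    and distr: "real_distribution (density lborel (\<lambda>x. ennreal (g x)))"
    and char: "\<And>z. char (density lborel (\<lambda>x. ennreal (g x))) z
        = exp (CLINT x|density lborel (\<lambda>x. ennreal (w x)). iexp (z * x) - 1)"
  shows "AE x in lborel. x * g x = (\<integral>y. y * w y * g (x - y) \<partial>lborel)"
proof -
  define F where "F = density lborel (\<lambda>x. ennreal (w x))"
  define \<eta> where "\<eta> = density lborel (\<lambda>x. ennreal (g x))"
  interpret \<eta>: real_distribution \<eta>
    using distr by (simp add: \<eta>_def)
  have sF[measurable_cong, simp]: "sets F = sets borel" by (simp add: F_def)
  have s\<eta>[measurable_cong]: "sets \<eta> = sets borel" by (simp add: \<eta>_def)
  have F1: "integrable F (\<lambda>x. x)"
    unfolding F_def by (subst integrable_real_density) (use w1 w0 in \<open>auto simp: mult.commute\<close>)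
  have F2: "integrable F (\<lambda>x. x\<^sup>2)"
    unfolding F_def by (subst integrable_real_density) (use w2 w0 in \<open>auto simp: mult.commute\<close>)
  have Fi: "integrable F (\<lambda>x. iexp (z * x) - 1)" for z
  proof (rule Bochner_Integration.integrable_bound)
    show "integrable F (\<lambda>x. z * x)" using F1 by simp
    show "AE x in F. norm (iexp (z * x) - 1) \<le> norm (z * x)"
      using norm_iexp_minus_one_le[of "z * x" for x] by (intro AE_I2) simp
  qed auto
  define \<psi> where "\<psi> z = (CLINT x|F. iexp (z * x) - 1)" for z
  have char\<psi>: "char \<eta> z = exp (\<psi> z)" for z
    using char[of z] by (simp add: \<psi>_def \<eta>_def F_def)
  \<comment> \<open>With m1 and m2 the integrals of |x| and x^2 under \<open>F\<close>, Re \<psi>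
    lies between - z^2 m2 / 2 and 0, and |Im \<psi>| \<le> |z| m1;
    \<open>one_minus_Re_exp_le\<close> turns this into the constant.\<close>
  have "1 - Re (char \<eta> z) \<le> ((\<integral>x. x\<^sup>2 \<partial>F) / 2 + (\<integral>x. \<bar>x\<bar> \<partial>F)\<^sup>2 / 2) * z\<^sup>2" for z
  proof -
    have re: "Re (\<psi> z) = (\<integral>x. Re (iexp (z * x) - 1) \<partial>F)"
      unfolding \<psi>_def by (rule integral_Re[OF Fi, symmetric])
    have im: "Im (\<psi> z) = (\<integral>x. Im (iexp (z * x) - 1) \<partial>F)"
      unfolding \<psi>_def by (rule integral_Im[OF Fi, symmetric])
    have "Re (\<psi> z) \<le> 0"
    proof -
      have "(\<integral>x. Re (iexp (z * x) - 1) \<partial>F) \<le> (\<integral>x. 0 \<partial>F)"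
        by (intro integral_mono integrable_Re Fi) (auto simp: Re_exp)
      then show ?thesis by (simp add: re)
    qed
    moreover have "- (z\<^sup>2 * (\<integral>x. x\<^sup>2 \<partial>F) / 2) \<le> Re (\<psi> z)"
    proof -
      have "- (z\<^sup>2 * (\<integral>x. x\<^sup>2 \<partial>F) / 2) = (\<integral>x. - ((z * x)\<^sup>2 / 2) \<partial>F)"
        by (simp add: power_mult_distrib)
      also have "\<dots> \<le> Re (\<psi> z)"
        unfolding re
      proof (rule integral_mono)
        show "- ((z * x)\<^sup>2 / 2) \<le> Re (iexp (z * x) - 1)" for x
          using one_minus_half_square_le_cos[of "z * x"] by (simp add: Re_exp)
        show "integrable F (\<lambda>x. - ((z * x)\<^sup>2 / 2))"
          using F2 by (simp add: power_mult_distrib)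
        show "integrable F (\<lambda>x. Re (iexp (z * x) - 1))"
          using Fi by (rule integrable_Re)
      qed
      finally show ?thesis .
    qed
    moreover have "\<bar>Im (\<psi> z)\<bar> \<le> \<bar>z\<bar> * (\<integral>x. \<bar>x\<bar> \<partial>F)"
    proof -
      have "\<bar>Im (\<psi> z)\<bar> \<le> (\<integral>x. \<bar>Im (iexp (z * x) - 1)\<bar> \<partial>F)"
        unfolding im by (rule integral_abs_bound)
      also have "\<dots> \<le> (\<integral>x. \<bar>z * x\<bar> \<partial>F)"
      proof (rule integral_mono)
        show "\<bar>Im (iexp (z * x) - 1)\<bar> \<le> \<bar>z * x\<bar>" for x
          using abs_Im_le_cmod[of "iexp (z * x) - 1"] norm_iexp_minus_one_le[of "z * x"] by simp
        show "integrable F (\<lambda>x. \<bar>Im (iexp (z * x) - 1)\<bar>)"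
          using Fi by (intro integrable_abs integrable_Im)
      qed (use F1 in auto)
      finally show ?thesis by (simp add: abs_mult)
    qed
    then have "(Im (\<psi> z))\<^sup>2 \<le> (\<bar>z\<bar> * (\<integral>x. \<bar>x\<bar> \<partial>F))\<^sup>2"
      by (rule abs_le_square_iff[THEN iffD1, OF order.trans]) simp
    ultimately show ?thesis
      using one_minus_Re_exp_le[of "\<psi> z"] by (simp add: char\<psi> power_mult_distrib algebra_simps)
  qed
  then have \<eta>1: "integrable \<eta> (\<lambda>x. x)"
    by (rule \<eta>.integrable_if_char_quadratic)
  \<comment> \<open>Both sides are limits of the same difference quotients of
    \<open>char \<eta>\<close>, taken once under the integral and once through
    \<open>exp (\<psi> z)\<close>.\<close>
  have deriv: "(CLINT x|\<eta>. \<i> * x * iexp (z * x)) = char \<eta> z * (CLINT x|F. \<i> * x * iexp (z * x))" for z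
  proof -
    define h where "h n = z + inverse (real (Suc n))" for n
    have i\<eta>: "integrable \<eta> (\<lambda>x. iexp (y * x))" for y
      by (rule \<eta>.integrable_iexp) auto
    have "(\<lambda>n. of_real (real (Suc n)) * (char \<eta> (h n) - char \<eta> z)) \<longlonglongrightarrow> (CLINT x|\<eta>. \<i> * x * iexp (z * x))"
    proof -
      have "char \<eta> (h n) - char \<eta> z = (CLINT x|\<eta>. iexp (h n * x) - iexp (z * x))" for n
        unfolding char_def by (rule Bochner_Integration.integral_diff[OF i\<eta> i\<eta>, symmetric])
      then show ?thesis
        using LIMSEQ_integral_iexp_difference_quotient[OF \<eta>1 s\<eta>, of z]
        by (simp add: h_def del: of_nat_Suc)
    qed
    moreover have "(\<lambda>n. of_real (real (Suc n)) * (\<psi> (h n) - \<psi> z)) \<longlonglongrightarrow> (CLINT x|F. \<i> * x * iexp (z * x))"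
    proof -
      have "\<psi> (h n) - \<psi> z = (CLINT x|F. iexp (h n * x) - iexp (z * x))" for n
        unfolding \<psi>_def using Fi by (subst Bochner_Integration.integral_diff[symmetric]) auto
      then show ?thesis
        using LIMSEQ_integral_iexp_difference_quotient[OF F1 sF, of z]
        by (simp add: h_def del: of_nat_Suc)
    qed
    from tendsto_mult_left[OF LIMSEQ_cexp_difference_quotient[OF this], of "char \<eta> z"]
    have "(\<lambda>n. of_real (real (Suc n)) * (char \<eta> (h n) - char \<eta> z)) \<longlonglongrightarrow> char \<eta> z * (CLINT x|F. \<i> * x * iexp (z * x))"
      by (simp add: char\<psi> exp_diff right_diff_distrib mult_ac del: of_nat_Suc)
    ultimately show ?thesis
      by (rule LIMSEQ_unique)
  qed
  define k where "k y = y * w y" for y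
  have k0: "0 \<le> k y" for y
    using w0[of y] by (cases "y < 0") (auto simp: k_def)
  have k[measurable]: "k \<in> borel_measurable borel" unfolding k_def by measurable
  have ki: "integrable lborel k" using w1 by (simp add: k_def[abs_def])
  have "(\<integral>\<^sup>+x. ennreal (g x) \<partial>lborel) = emeasure \<eta> (space \<eta>)"
    unfolding \<eta>_def by (subst emeasure_density) auto
  then have gi: "integrable lborel g"
    using g0 \<eta>.emeasure_space_1 by (intro integrableI_nonneg) auto
  have gxi: "integrable lborel (\<lambda>x. x * g x)"
    using \<eta>1 g0 unfolding \<eta>_def by (subst (asm) integrable_real_density) (auto simp: mult.commute)
  define G where "G x = (\<integral>y. k y * g (x - y) \<partial>lborel)" for x
  have Gi: "integrable lborel G"
    unfolding G_def[abs_def] by (rule integrable_convolution[OF ki gi])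
  have G0: "0 \<le> G x" for x
    unfolding G_def using k0 g0 by (intro Bochner_Integration.integral_nonneg) auto
  \<comment> \<open>So far x g(x) may change sign, while \<open>AE_eq_if_Fourier_eq\<close> wants
    nonnegative functions. Hence x g(x) = u - v is split into its positive and negative parts, and
    the identity is proved in the form u = v + G.\<close>
  define u where "u x = max 0 x * g x" for x
  define v where "v x = max 0 (- x) * g x" for x
  have [measurable]: "u \<in> borel_measurable borel" "v \<in> borel_measurable borel"
    unfolding u_def v_def by auto
  have "\<bar>u x\<bar> \<le> \<bar>x * g x\<bar>" "\<bar>v x\<bar> \<le> \<bar>x * g x\<bar>" for x
    using g0[of x] by (auto simp: u_def v_def max_def abs_mult mult_nonpos_nonneg)
  then have ui: "integrable lborel u" and vi: "integrable lborel v"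
    by (auto intro!: Bochner_Integration.integrable_bound[OF gxi])
  have mult_iexp: "integrable lborel (\<lambda>x. f x * iexp (z * x))" if "integrable lborel f" for f :: "real \<Rightarrow> real" and z
    by (rule Bochner_Integration.integrable_bound[OF that]) (use that in \<open>auto simp: norm_mult\<close>)
  have "AE x in lborel. u x = v x + G x"
  proof (rule AE_eq_if_Fourier_eq)
    fix z
    have "(CLINT x|lborel. u x * iexp (z * x)) - (CLINT x|lborel. v x * iexp (z * x))
        = (CLINT x|lborel. u x * iexp (z * x) - v x * iexp (z * x))"
      by (intro Bochner_Integration.integral_diff[symmetric] mult_iexp ui vi)
    also have "\<dots> = (CLINT x|lborel. g x *\<^sub>R (x * iexp (z * x)))"
      by (intro Bochner_Integration.integral_cong) (auto simp: u_def v_def max_def scaleR_conv_of_real)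
    also have "\<dots> = (CLINT x|\<eta>. x * iexp (z * x))"
      unfolding \<eta>_def using g0 by (intro integral_density[symmetric]) auto
    also have "\<dots> = char \<eta> z * (CLINT x|F. x * iexp (z * x))"
      using deriv[of z] by (simp add: mult.assoc mult.left_commute)
    also have "(CLINT x|F. x * iexp (z * x)) = (CLINT x|lborel. w x *\<^sub>R (x * iexp (z * x)))"
      unfolding F_def using w0 by (intro integral_density) auto
    also have "\<dots> = (CLINT x|lborel. k x * iexp (z * x))"
      by (simp add: k_def scaleR_conv_of_real mult_ac)
    also have "char \<eta> z = (CLINT x|lborel. g x * iexp (z * x))"
      unfolding char_def \<eta>_def using g0 by (subst integral_density) (auto simp: scaleR_conv_of_real)
    also have "\<dots> * (CLINT x|lborel. k x * iexp (z * x)) = (CLINT x|lborel. G x * iexp (z * x))"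
      unfolding G_def by (rule Fourier_convolution[OF ki gi, symmetric])
    finally have "(CLINT x|lborel. u x * iexp (z * x))
        = (CLINT x|lborel. v x * iexp (z * x)) + (CLINT x|lborel. G x * iexp (z * x))"
      by (simp add: algebra_simps)
    also have "\<dots> = (CLINT x|lborel. v x * iexp (z * x) + G x * iexp (z * x))"
      by (intro Bochner_Integration.integral_add[symmetric] mult_iexp vi Gi)
    finally show "(CLINT x|lborel. u x * iexp (z * x)) = (CLINT x|lborel. (v x + G x) * iexp (z * x))"
      by (simp add: distrib_right)
    show "integrable lborel u" by (rule ui)
    show "integrable lborel (\<lambda>x. v x + G x)" using vi Gi by simp
    show "0 \<le> u x" "0 \<le> v x + G x" for x
      using g0[of x] G0[of x] by (simp_all add: u_def v_def)
  qed
  then show ?thesis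
    by (elim eventually_mono) (auto simp: u_def v_def G_def k_def max_def split: if_splits)
qed

text \<open>The set where the two functions differ is open and null, hence empty.\<close>

lemma continuous_eq_if_AE_eq:
  fixes f g :: "real \<Rightarrow> real"
  assumes ae: "AE x in lborel. x \<in> S \<longrightarrow> f x = g x" and S: "open S"
    and f: "continuous_on S f" and g: "continuous_on S g" and x: "x \<in> S"
  shows "f x = g x"
proof (rule ccontr)
  assume ne: "f x \<noteq> g x"
  define U where "U = {x \<in> S. f x - g x \<noteq> 0}"
  have "open (S \<inter> (\<lambda>x. f x - g x) -` (- {0}))"
    using S f g by (intro continuous_open_preimage continuous_intros) auto
  also have "S \<inter> (\<lambda>x. f x - g x) -` (- {0}) = U"
    by (auto simp: U_def)
  finally have U: "open U" .
  have "AE x in lborel. x \<notin> U"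
    using ae by (elim eventually_mono) (auto simp: U_def)
  then have "U \<in> null_sets lborel"
    using U by (subst AE_iff_null_sets) auto
  then have "negligible U"
    by (simp add: negligible_iff_null_sets null_sets_completionI)
  with U open_not_negligible have "U = {}" by blast
  with ne x show False by (auto simp: U_def)
qed

section \<open>The Laplace transform of a solution of the Volterra equation\<close>

lemma abs_exp_minus_one_le: "\<bar>exp t - 1\<bar> \<le> \<bar>t\<bar> * exp \<bar>t :: real\<bar>"
proof (cases "0 \<le> t")
  case True
  have "(1 - t) * exp t \<le> exp (- t) * exp t"
    using exp_ge_add_one_self[of "- t"] by (intro mult_right_mono) auto
  then show ?thesis
    using True by (simp add: algebra_simps flip: exp_add)
next
  case False
  have "\<bar>t\<bar> * 1 \<le> \<bar>t\<bar> * exp \<bar>t\<bar>"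
    by (intro mult_left_mono) auto
  moreover have "\<bar>t\<bar> = - t" "\<bar>exp t - 1\<bar> = 1 - exp t"
    using False by auto
  ultimately show ?thesis
    using exp_ge_add_one_self[of t] by linarith
qed

section \<open>Laplace transforms of integrable functions on the half-line\<close>

context
  fixes u :: "real \<Rightarrow> real"
  assumes u: "integrable lborel u" and u0: "\<And>x. x < 0 \<Longrightarrow> u x = 0"
begin

lemma norm_Laplace_integrand_le:
  assumes "0 \<le> p"
  shows "\<bar>exp (- p * x) * u x\<bar> \<le> \<bar>u x\<bar>"
  using assms u0[of x] by (cases "x < 0") (auto simp: abs_mult intro!: mult_left_le_one_le)

lemma Laplace_integrable: "0 \<le> p \<Longrightarrow> integrable lborel (\<lambda>x. exp (- p * x) * u x)"
  using u norm_Laplace_integrand_le by (intro Bochner_Integration.integrable_bound[OF u]) auto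

lemma Laplace_continuous_on: "continuous_on {0..} (\<lambda>p. \<integral>x. exp (- p * x) * u x \<partial>lborel)"
  unfolding continuous_on_sequentially o_def
proof safe
  fix q :: "nat \<Rightarrow> real" and p
  assume q: "\<forall>n. q n \<in> {0..}" "q \<longlonglongrightarrow> p" 
  show "(\<lambda>n. \<integral>x. exp (- q n * x) * u x \<partial>lborel) \<longlonglongrightarrow> (\<integral>x. exp (- p * x) * u x \<partial>lborel)"
  proof (rule integral_dominated_convergence)
    show "integrable lborel (\<lambda>x. \<bar>u x\<bar>)" using u by simp
    show "AE x in lborel. norm (exp (- q n * x) * u x) \<le> \<bar>u x\<bar>" for n
      using norm_Laplace_integrand_le q by (intro AE_I2) simp
    show "AE x in lborel. (\<lambda>n. exp (- q n * x) * u x) \<longlonglongrightarrow> exp (- p * x) * u x"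
      by (intro AE_I2 tendsto_intros q)
  qed (use u in auto)
qed

lemma
  assumes p: "0 < p"
  shows Laplace_deriv_integrable: "integrable lborel (\<lambda>x. x * exp (- p * x) * u x)"
    and Laplace_has_real_derivative:
      "((\<lambda>p. \<integral>x. exp (- p * x) * u x \<partial>lborel) has_real_derivative
         - (\<integral>x. x * exp (- p * x) * u x \<partial>lborel)) (at p)"
proof -
  have xexp: "x * exp (- (p / 2) * x) \<le> 2 / p" for x
  proof -
    have "p / 2 * x \<le> exp (p / 2 * x)"
      using exp_ge_add_one_self[of "p / 2 * x"] by linarith
    then have "(p / 2 * x) * exp (- (p / 2) * x) \<le> exp (p / 2 * x) * exp (- (p / 2) * x)"
      by (rule mult_right_mono) simp
    then show ?thesis
      using p by (simp add: field_simps flip: exp_add)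
  qed
  \<comment> \<open>Half of the decay of exp(-px) absorbs exp(|h| x), the other half absorbs the
    factor x; what remains is a multiple of the integrable |u|.\<close>
  have bound: "\<bar>(exp (- (p + h) * x) * u x - exp (- p * x) * u x) / h\<bar> \<le> 2 / p * \<bar>u x\<bar>" if h: "\<bar>h\<bar> < p / 2" "h \<noteq> 0" for h x
  proof (cases "x < 0")
    case False
    have "\<bar>(exp (- (p + h) * x) - exp (- p * x)) / h\<bar> = exp (- p * x) * \<bar>exp (- h * x) - 1\<bar> / \<bar>h\<bar>"
    proof -
      have "exp (- (p + h) * x) - exp (- p * x) = exp (- p * x) * (exp (- h * x) - 1)"
        by (simp add: algebra_simps flip: exp_add)
      then show ?thesis by (simp add: abs_mult)
    qed
    also have "\<dots> \<le> exp (- p * x) * (\<bar>- h * x\<bar> * exp \<bar>- h * x\<bar>) / \<bar>h\<bar>"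
      by (intro divide_right_mono mult_left_mono abs_exp_minus_one_le) auto
    also have "\<dots> = x * exp (- p * x + \<bar>h\<bar> * x)"
      using False h by (simp add: abs_mult mult.left_commute flip: exp_add)
    also have "\<dots> \<le> x * exp (- (p / 2) * x)"
    proof -
      have "\<bar>h\<bar> * x \<le> p / 2 * x"
        using h False by (intro mult_right_mono) auto
      then show ?thesis
        using False by (intro mult_left_mono) (auto simp: algebra_simps)
    qed
    also have "\<dots> \<le> 2 / p" by (rule xexp)
    finally have "\<bar>(exp (- (p + h) * x) - exp (- p * x)) / h\<bar> * \<bar>u x\<bar> \<le> 2 / p * \<bar>u x\<bar>"
      by (rule mult_right_mono) simp
    then show ?thesis
      by (simp add: abs_mult[symmetric] algebra_simps)
  qed (use u0 in simp)
  have lim: "((\<lambda>h. (exp (- (p + h) * x) * u x - exp (- p * x) * u x) / h) \<longlongrightarrow> - (x * exp (- p * x) * u x)) (at 0)" for x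
  proof -
    have "((\<lambda>p. exp (- p * x) * u x) has_real_derivative - (x * exp (- p * x) * u x)) (at p)"
      by (auto intro!: derivative_eq_intros)
    then show ?thesis by (simp only: DERIV_def)
  qed
  \<comment> \<open>Within this ball p + h stays positive and \<open>bound\<close> applies to every
    term of a test sequence, not just eventually.\<close>
  have at0: "at (0::real) = at 0 within ball 0 (p / 2)"
    using p by (intro at_within_open[symmetric]) auto
  have *: "integrable lborel (\<lambda>x. - (x * exp (- p * x) * u x)) \<and>
      (\<lambda>n. \<integral>x. (exp (- (p + h n) * x) * u x - exp (- p * x) * u x) / h n \<partial>lborel)
        \<longlonglongrightarrow> (\<integral>x. - (x * exp (- p * x) * u x) \<partial>lborel)"
    if h: "\<forall>n. h n \<in> ball 0 (p / 2) - {0}" "h \<longlonglongrightarrow> 0" for h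
  proof (intro conjI)
    have 1: "(\<lambda>x. - (x * exp (- p * x) * u x)) \<in> borel_measurable lborel"
      "(\<lambda>x. (exp (- (p + h n) * x) * u x - exp (- p * x) * u x) / h n) \<in> borel_measurable lborel" for n
      using u by auto
    have 2: "integrable lborel (\<lambda>x. 2 / p * \<bar>u x\<bar>)" using u by simp
    have 3: "AE x in lborel. (\<lambda>n. (exp (- (p + h n) * x) * u x - exp (- p * x) * u x) / h n)
       \<longlonglongrightarrow> - (x * exp (- p * x) * u x)"
    proof (rule AE_I2)
      fix x
      show "(\<lambda>n. (exp (- (p + h n) * x) * u x - exp (- p * x) * u x) / h n)
       \<longlonglongrightarrow> - (x * exp (- p * x) * u x)"
        by (rule filterlim_compose[OF lim]) (use h in \<open>auto simp: filterlim_at\<close>)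
    qed
    have 4: "AE x in lborel. norm ((exp (- (p + h n) * x) * u x - exp (- p * x) * u x) / h n) \<le> 2 / p * \<bar>u x\<bar>" for n
      using h(1) bound[of "h n"] by (intro AE_I2) (simp add: dist_real_def)
    show "integrable lborel (\<lambda>x. - (x * exp (- p * x) * u x))"
      by (rule integrable_dominated_convergence[OF 1 2 3 4])
    show "(\<lambda>n. \<integral>x. (exp (- (p + h n) * x) * u x - exp (- p * x) * u x) / h n \<partial>lborel)
        \<longlonglongrightarrow> (\<integral>x. - (x * exp (- p * x) * u x) \<partial>lborel)"
      by (rule integral_dominated_convergence[OF 1 2 3 4])
  qed
  \<comment> \<open>One concrete sequence yields the integrability. The shift to n + 2 puts even the
    first term strictly inside the open ball.\<close>
  have "\<forall>n. p / 2 * inverse (real (Suc (Suc n))) \<in> ball 0 (p / 2) - {0}"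
    using p by (auto simp: dist_real_def field_simps intro!: add_pos_nonneg)
  moreover have "(\<lambda>n. p / 2 * inverse (real (Suc (Suc n)))) \<longlonglongrightarrow> 0"
    using tendsto_mult_left[OF LIMSEQ_Suc[OF LIMSEQ_inverse_real_of_nat], of "p / 2"] by simp
  ultimately have "integrable lborel (\<lambda>x. - (x * exp (- p * x) * u x))"
    by (rule *[THEN conjunct1])
  then show "integrable lborel (\<lambda>x. x * exp (- p * x) * u x)"
    by simp
  show "((\<lambda>p. \<integral>x. exp (- p * x) * u x \<partial>lborel) has_real_derivative
         - (\<integral>x. x * exp (- p * x) * u x \<partial>lborel)) (at p)"
    unfolding DERIV_def
  proof (subst at0, unfold tendsto_at_iff_sequentially o_def, safe)
    fix h :: "nat \<Rightarrow> real" assume h: "\<forall>n. h n \<in> ball 0 (p / 2) - {0}" "h \<longlonglongrightarrow> 0"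
    have "((\<integral>x. exp (- (p + h n) * x) * u x \<partial>lborel) - (\<integral>x. exp (- p * x) * u x \<partial>lborel)) / h n
        = (\<integral>x. (exp (- (p + h n) * x) * u x - exp (- p * x) * u x) / h n \<partial>lborel)" for n
    proof -
      have "\<bar>h n\<bar> < p / 2" using h(1) by (auto simp: dist_real_def)
      then have "0 \<le> p + h n" by linarith
      then show ?thesis
        using p by (simp only: integral_divide_zero Bochner_Integration.integral_diff[OF Laplace_integrable Laplace_integrable] less_imp_le)
    qed
    then show "(\<lambda>n. ((\<integral>x. exp (- (p + h n) * x) * u x \<partial>lborel) - (\<integral>x. exp (- p * x) * u x \<partial>lborel)) / h n)
       \<longlonglongrightarrow> - (\<integral>x. x * exp (- p * x) * u x \<partial>lborel)"
      using *[OF h] by (simp only: Bochner_Integration.integral_minus)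
  qed
qed

end

text \<open>The Laplace transform times exp(c p^b) is constant on [0, l]: by \<open>one\<close> its
  value at l is exp(c l^b), and its value at 0 is the integral of \<open>f\<close>. For
  \<open>f\<close> cut off at X the product is merely increasing, but that bounds the integral
  uniformly in X and so makes \<open>f\<close> integrable.\<close>

lemma integral_if_Volterra:
  fixes f :: "real \<Rightarrow> real" and a b l :: real
  defines "\<kappa> \<equiv> \<lambda>y. a * (y powr (- b) * indicator {0<..} y)"
  assumes a: "0 < a" and b: "0 < b" "b < 1" and l: "0 < l"
    and f[measurable]: "f \<in> borel_measurable borel" and f0: "\<And>x. 0 \<le> f x" "\<And>x. x < 0 \<Longrightarrow> f x = 0"
    and int: "\<And>x. integrable lborel (\<lambda>y. \<kappa> y * f (x - y))"
    and eq: "\<And>x. x * f x = (\<integral>y. \<kappa> y * f (x - y) \<partial>lborel)"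
    and one: "has_bochner_integral lborel (\<lambda>x. exp (- l * x) * f x) 1"
  shows "has_bochner_integral lborel f (exp (a * Gamma (1 - b) / b * l powr b))"
proof -
  have [measurable]: "\<kappa> \<in> borel_measurable borel" unfolding \<kappa>_def by measurable
  have \<kappa>0: "0 \<le> \<kappa> y" for y using a by (simp add: \<kappa>_def)
  \<comment> \<open>The division by b makes \<open>c * p powr b\<close> an antiderivative of
    \<open>K\<close>, the Laplace transform of \<kappa>.\<close>
  define c where "c = a * Gamma (1 - b) / b"
  define K where "K p = c * b * p powr (b - 1)" for p
  have K0: "0 \<le> K p" for p
    using a b Gamma_real_pos[of "1 - b"] by (auto simp: K_def c_def intro!: mult_nonneg_nonneg less_imp_le[OF Gamma_real_pos])
  have nnK: "(\<integral>\<^sup>+y. ennreal (\<kappa> y * exp (- p * y)) \<partial>lborel) = ennreal (K p)" if "0 < p" for p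
  proof -
    have h: "has_bochner_integral lborel (\<lambda>y. a * (y powr ((1 - b) - 1) * exp (- p * y) * indicator {0<..} y)) (a * (Gamma (1 - b) / p powr (1 - b)))"
      using a b that by (intro has_bochner_integral_mult_right has_bochner_integral_powr_exp) auto
    have "(\<lambda>y. a * (y powr ((1 - b) - 1) * exp (- p * y) * indicator {0<..} y)) = (\<lambda>y. \<kappa> y * exp (- p * y))"
      by (auto simp: \<kappa>_def)
    moreover have "a * (Gamma (1 - b) / p powr (1 - b)) = K p"
      using b powr_minus_divide[of p "1 - b"] by (simp add: K_def c_def)
    ultimately have "has_bochner_integral lborel (\<lambda>y. \<kappa> y * exp (- p * y)) (K p)"
      using h by simp
    then show ?thesis
      using \<kappa>0 by (subst nn_integral_eq_integral) (auto simp: has_bochner_integral_iff)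
  qed
  \<comment> \<open>The Volterra equation is multiplied by exp(-px), integrated over S, and the
    integrals are exchanged. With nonnegative integrals this is legitimate before any integrability
    is known. The cases used are S = \<open>{..X}\<close> and S = \<open>UNIV\<close>.\<close>
  have nnD: "(\<integral>\<^sup>+x. ennreal (x * exp (- p * x) * (f x * indicator S x)) \<partial>lborel) =
     (\<integral>\<^sup>+y. ennreal (\<kappa> y * exp (- p * y)) * (\<integral>\<^sup>+x. ennreal (exp (- p * x) * (f x * indicator S (x + y))) \<partial>lborel) \<partial>lborel)"
    if [measurable]: "S \<in> sets borel" for S p
  proof -
    have "(\<integral>\<^sup>+x. ennreal (x * exp (- p * x) * (f x * indicator S x)) \<partial>lborel)
      = (\<integral>\<^sup>+x. (\<integral>\<^sup>+y. ennreal (\<kappa> y * exp (- p * y)) * ennreal (exp (- p * (x - y)) * (f (x - y) * indicator S x)) \<partial>lborel) \<partial>lborel)"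
    proof (intro nn_integral_cong)
      fix x
      have "ennreal (x * exp (- p * x) * (f x * indicator S x)) = ennreal (exp (- p * x) * indicator S x) * ennreal (x * f x)"
        by (subst ennreal_mult'[symmetric]) (auto simp: mult_ac)
      also have "ennreal (x * f x) = (\<integral>\<^sup>+y. ennreal (\<kappa> y * f (x - y)) \<partial>lborel)"
        unfolding eq using \<kappa>0 f0 by (intro nn_integral_eq_integral[symmetric] int) auto
      also have "ennreal (exp (- p * x) * indicator S x) * \<dots> = (\<integral>\<^sup>+y. ennreal (exp (- p * x) * indicator S x) * ennreal (\<kappa> y * f (x - y)) \<partial>lborel)"
        by (intro nn_integral_cmult[symmetric]) auto
      also have "\<dots> = (\<integral>\<^sup>+y. ennreal (\<kappa> y * exp (- p * y)) * ennreal (exp (- p * (x - y)) * (f (x - y) * indicator S x)) \<partial>lborel)"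
      proof (intro nn_integral_cong)
        fix y
        have "exp (- p * x) = exp (- p * y) * exp (- p * (x - y))"
          by (simp add: algebra_simps flip: exp_add)
        then show "ennreal (exp (- p * x) * indicator S x) * ennreal (\<kappa> y * f (x - y)) = ennreal (\<kappa> y * exp (- p * y)) * ennreal (exp (- p * (x - y)) * (f (x - y) * indicator S x))"
          using \<kappa>0 f0 by (simp add: mult_ac flip: ennreal_mult)
      qed
      finally show "ennreal (x * exp (- p * x) * (f x * indicator S x)) = (\<integral>\<^sup>+y. ennreal (\<kappa> y * exp (- p * y)) * ennreal (exp (- p * (x - y)) * (f (x - y) * indicator S x)) \<partial>lborel)" .
    qed
    also have "\<dots> = (\<integral>\<^sup>+y. (\<integral>\<^sup>+x. ennreal (\<kappa> y * exp (- p * y)) * ennreal (exp (- p * (x - y)) * (f (x - y) * indicator S x)) \<partial>lborel) \<partial>lborel)"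
      by (rule lborel_pair.Fubini') measurable
    also have "\<dots> = (\<integral>\<^sup>+y. ennreal (\<kappa> y * exp (- p * y)) * (\<integral>\<^sup>+x. ennreal (exp (- p * x) * (f x * indicator S (x + y))) \<partial>lborel) \<partial>lborel)"
    proof (intro nn_integral_cong)
      fix y
      have "(\<integral>\<^sup>+x. ennreal (exp (- p * (x - y)) * (f (x - y) * indicator S x)) \<partial>lborel) = (\<integral>\<^sup>+x. ennreal (exp (- p * x) * (f x * indicator S (x + y))) \<partial>lborel)"
        by (subst nn_integral_real_affine[where c = 1 and t = y]) (auto simp: add.commute)
      then show "(\<integral>\<^sup>+x. ennreal (\<kappa> y * exp (- p * y)) * ennreal (exp (- p * (x - y)) * (f (x - y) * indicator S x)) \<partial>lborel) = ennreal (\<kappa> y * exp (- p * y)) * (\<integral>\<^sup>+x. ennreal (exp (- p * x) * (f x * indicator S (x + y))) \<partial>lborel)"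
        by (subst nn_integral_cmult) auto
    qed
    finally show ?thesis .
  qed
  define L where "L u p = (\<integral>x. exp (- p * x) * u x \<partial>lborel)" for u :: "real \<Rightarrow> real" and p
  define D where "D u p = (\<integral>x. x * exp (- p * x) * u x \<partial>lborel)" for u :: "real \<Rightarrow> real" and p
  have xf: "0 \<le> x * f x" for x using f0[of x] by (cases "x < 0") auto
  have nnL: "(\<integral>\<^sup>+x. ennreal (exp (- p * x) * u x) \<partial>lborel) = ennreal (L u p)"
    if "integrable lborel u" "\<And>x. x < 0 \<Longrightarrow> u x = 0" "\<And>x. 0 \<le> u x" "0 \<le> p" for u p
    unfolding L_def using that by (intro nn_integral_eq_integral Laplace_integrable) auto
  have nnD': "(\<integral>\<^sup>+x. ennreal (x * exp (- p * x) * u x) \<partial>lborel) = ennreal (D u p)"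
    if "integrable lborel u" "\<And>x. x < 0 \<Longrightarrow> u x = 0" "\<And>x. 0 \<le> u x" "0 < p" for u p
    unfolding D_def
  proof (intro nn_integral_eq_integral Laplace_deriv_integrable AE_I2)
    show "0 \<le> x * exp (- p * x) * u x" for x
      using that(2)[of x] that(3)[of x] by (cases "x < 0") auto
  qed (use that in auto)
  \<comment> \<open>exp(c p^b) is the integrating factor of L' = - K L.\<close>
  define H where "H u p = L u p * exp (c * p powr b)" for u :: "real \<Rightarrow> real" and p
  have H_deriv: "(H u has_real_derivative (K p * L u p - D u p) * exp (c * p powr b)) (at p)"
    if "integrable lborel u" "\<And>x. x < 0 \<Longrightarrow> u x = 0" "0 < p" for u p
  proof -
    have "(L u has_real_derivative - D u p) (at p)"
      unfolding L_def D_def by (rule Laplace_has_real_derivative) (use that in auto)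
    then have "(H u has_real_derivative (- D u p * exp (c * p powr b) + exp (c * p powr b) * (c * (b * p powr (b - 1))) * L u p)) (at p)"
      unfolding H_def using that(3) by (auto intro!: derivative_eq_intros)
    then show ?thesis by (simp add: K_def algebra_simps)
  qed
  \<comment> \<open>\<open>K\<close> blows up at 0, so derivatives are used on the open interval
    only; continuity, which rests on b > 0, extends the comparison to p = 0.\<close>
  have H_cont: "continuous_on {0..l} (H u)" if "integrable lborel u" "\<And>x. x < 0 \<Longrightarrow> u x = 0" for u
  proof -
    have "continuous_on {0..l} (L u)"
      unfolding L_def using that by (intro continuous_on_subset[OF Laplace_continuous_on]) auto
    then show ?thesis
      unfolding H_def using b by (intro continuous_intros continuous_on_powr') auto
  qed
  have H0: "H u 0 = integral\<^sup>L lborel u" for u by (simp add: H_def L_def)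
  have Ll: "L f l = 1" "integrable lborel (\<lambda>x. exp (- l * x) * f x)"
    using one by (auto simp: L_def has_bochner_integral_iff)
  have trunc: "integrable lborel (\<lambda>x. f x * indicator {..X} x) \<and> (\<integral>x. f x * indicator {..X} x \<partial>lborel) \<le> exp (c * l powr b)" for X
  proof -
    define u where "u x = f x * indicator {..X} x" for x
    have [measurable]: "u \<in> borel_measurable borel" unfolding u_def by measurable
    have u0: "0 \<le> u x" "x < 0 \<Longrightarrow> u x = 0" for x
      using f0 by (auto simp: u_def)
    have ui: "integrable lborel u"
    proof (rule Bochner_Integration.integrable_bound)
      show "integrable lborel (\<lambda>x. exp (l * X) * (exp (- l * x) * f x))" using Ll by simp
      have "1 \<le> exp (l * X) * exp (- l * x)" if "x \<le> X" for x
        using that l by (simp add: algebra_simps flip: exp_add)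
      from mult_right_mono[OF this f0(1)]
      show "AE x in lborel. norm (u x) \<le> norm (exp (l * X) * (exp (- l * x) * f x))"
        using f0 by (intro AE_I2) (auto simp: u_def indicator_def abs_mult mult.assoc)
    qed (simp add: u_def)
    \<comment> \<open>\<kappa> y is nonzero only for y > 0, and then x + y \<le> X implies x \<le>
      X. Replacing the cutoff of x + y by that of x can thus only enlarge the right-hand
      side.\<close>
    have DK: "D u p \<le> K p * L u p" if p: "0 < p" for p
    proof -
      have "ennreal (D u p) = (\<integral>\<^sup>+x. ennreal (x * exp (- p * x) * u x) \<partial>lborel)"
        using ui u0 p by (intro nnD'[symmetric]) auto
      also have "\<dots> = (\<integral>\<^sup>+y. ennreal (\<kappa> y * exp (- p * y)) * (\<integral>\<^sup>+x. ennreal (exp (- p * x) * (f x * indicator {..X} (x + y))) \<partial>lborel) \<partial>lborel)"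
        unfolding u_def by (rule nnD) auto
      also have "\<dots> \<le> (\<integral>\<^sup>+y. ennreal (\<kappa> y * exp (- p * y)) * (\<integral>\<^sup>+x. ennreal (exp (- p * x) * u x) \<partial>lborel) \<partial>lborel)"
      proof (intro nn_integral_mono)
        fix y :: real
        show "ennreal (\<kappa> y * exp (- p * y)) * (\<integral>\<^sup>+x. ennreal (exp (- p * x) * (f x * indicator {..X} (x + y))) \<partial>lborel)
          \<le> ennreal (\<kappa> y * exp (- p * y)) * (\<integral>\<^sup>+x. ennreal (exp (- p * x) * u x) \<partial>lborel)"
        proof (cases "y > 0")
          case True
          then show ?thesis
            using f0 by (intro mult_left_mono nn_integral_mono ennreal_leI) (auto simp: u_def indicator_def)
        qed (simp add: \<kappa>_def)
      qed
      also have "\<dots> = ennreal (K p) * ennreal (L u p)"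
        using nnK[OF p] nnL[OF ui u0(2) u0(1), of p] p by (simp add: nn_integral_multc)
      also have "\<dots> = ennreal (K p * L u p)"
        using K0 by (simp add: ennreal_mult')
      finally show ?thesis
        using u0 K0 by (subst (asm) ennreal_le_iff) (auto simp: L_def intro!: mult_nonneg_nonneg Bochner_Integration.integral_nonneg)
    qed
    have "H u 0 \<le> H u l"
    proof (rule DERIV_nonneg_imp_increasing_open[OF less_imp_le[OF l] _ H_cont[OF ui u0(2)]])
      fix p assume "0 < p" "p < l"
      then show "\<exists>y. (H u has_real_derivative y) (at p) \<and> 0 \<le> y"
        using H_deriv[OF ui u0(2), of p] DK[of p] by (intro exI conjI) (auto intro!: mult_nonneg_nonneg)
    qed
    also have "H u l \<le> 1 * exp (c * l powr b)"
    proof -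
      have "L u l \<le> L f l"
        unfolding L_def
      proof (rule integral_mono[OF Laplace_integrable[OF ui u0(2) less_imp_le[OF l]] Ll(2)])
        show "exp (- l * x) * u x \<le> exp (- l * x) * f x" for x
          using f0 by (intro mult_left_mono) (auto simp: u_def indicator_def)
      qed
      then show ?thesis
        unfolding H_def Ll(1) by (intro mult_right_mono) auto
    qed
    finally show ?thesis
      using ui unfolding H0 u_def by simp
  qed
  \<comment> \<open>Fatou along the cutoffs X = n, whose integrals share the bound from
    \<open>trunc\<close>.\<close>
  have fi: "integrable lborel f"
  proof (rule integrableI_nonneg)
    have "(\<integral>\<^sup>+x. ennreal (f x) \<partial>lborel) = (\<integral>\<^sup>+x. liminf (\<lambda>n. ennreal (f x * indicator {..real n} x)) \<partial>lborel)"
    proof (intro nn_integral_cong)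
      fix x
      obtain N where N: "x \<le> real N" using real_arch_simple by blast
      have "(\<lambda>n. ennreal (f x * indicator {..real n} x)) \<longlonglongrightarrow> ennreal (f x)"
        by (rule tendsto_eventually, rule eventually_sequentiallyI[of N]) (use N in auto)
      from lim_imp_Liminf[OF _ this]
      show "ennreal (f x) = liminf (\<lambda>n. ennreal (f x * indicator {..real n} x))" by simp
    qed
    also have "\<dots> \<le> liminf (\<lambda>n. \<integral>\<^sup>+x. ennreal (f x * indicator {..real n} x) \<partial>lborel)"
      by (intro nn_integral_liminf) auto
    also have "\<dots> \<le> ennreal (exp (c * l powr b))"
    proof (rule Liminf_le, simp, rule always_eventually, rule allI)
      fix n
      have "(\<integral>\<^sup>+x. ennreal (f x * indicator {..real n} x) \<partial>lborel) = ennreal (\<integral>x. f x * indicator {..real n} x \<partial>lborel)"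
        using trunc f0 by (intro nn_integral_eq_integral) auto
      then show "(\<integral>\<^sup>+x. ennreal (f x * indicator {..real n} x) \<partial>lborel) \<le> ennreal (exp (c * l powr b))"
        using trunc by (simp add: ennreal_leI)
    qed
    finally show "(\<integral>\<^sup>+x. ennreal (f x) \<partial>lborel) < \<infinity>"
      using ennreal_less_top le_less_trans infinity_ennreal_def by metis
  qed (use f0 in auto)
  have DK: "D f p = K p * L f p" if p: "0 < p" for p
  proof -
    have "ennreal (D f p) = (\<integral>\<^sup>+x. ennreal (x * exp (- p * x) * f x) \<partial>lborel)"
      using fi f0 p by (intro nnD'[symmetric]) auto
    also have "\<dots> = (\<integral>\<^sup>+y. ennreal (\<kappa> y * exp (- p * y)) * (\<integral>\<^sup>+x. ennreal (exp (- p * x) * f x) \<partial>lborel) \<partial>lborel)"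
      using nnD[of UNIV p] by simp
    also have "\<dots> = ennreal (K p) * ennreal (L f p)"
      using nnK[OF p] nnL[OF fi f0(2) f0(1), of p] p by (simp add: nn_integral_multc)
    also have "\<dots> = ennreal (K p * L f p)"
      using K0 by (simp add: ennreal_mult')
    finally show ?thesis
    proof (subst (asm) ennreal_inj)
      show "0 \<le> K p * L f p"
        using K0 f0 by (auto simp: L_def intro!: mult_nonneg_nonneg Bochner_Integration.integral_nonneg)
      have "0 \<le> x * exp (- p * x) * f x" for x
        using mult_nonneg_nonneg[OF xf[of x], of "exp (- p * x)"] by (simp add: mult_ac)
      then show "0 \<le> D f p"
        unfolding D_def by (intro Bochner_Integration.integral_nonneg) auto
    qed
  qed
  have "H f l = H f 0"
  proof (rule DERIV_isconst_end[OF l H_cont[OF fi f0(2)]])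
    fix p assume "0 < p" "p < l"
    then show "(H f has_real_derivative 0) (at p)"
      using H_deriv[OF fi f0(2), of p] DK[of p] by simp
  qed
  then show ?thesis
    using fi unfolding has_bochner_integral_iff H0 by (simp add: H_def Ll c_def)
qed

section \<open>Asymptotics\<close>

text \<open>On (0, d] one has 1 \<le> exp(1 - y/d), so e times the Gamma integral at rate 1/d is a
  majorant. The constant is not sharp; only the power of d matters.\<close>

lemma
  fixes b d :: real
  assumes b: "b < 1" and d: "0 < d"
  shows integrable_powr_truncated: "integrable lborel (\<lambda>y. y powr (- b) * indicator {0<..d} y)"
    and integral_powr_truncated_le: "(\<integral>y. y powr (- b) * indicator {0<..d} y \<partial>lborel) \<le> exp 1 * Gamma (1 - b) * d powr (1 - b)"
proof -
  have h: "has_bochner_integral lborel (\<lambda>y. exp 1 * (y powr (1 - b - 1) * exp (- (1 / d) * y) * indicator {0<..} y))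
      (exp 1 * (Gamma (1 - b) / (1 / d) powr (1 - b)))"
    using b d by (intro has_bochner_integral_mult_right has_bochner_integral_powr_exp) auto
  have le: "y powr (- b) * indicator {0<..d} y \<le> exp 1 * (y powr (1 - b - 1) * exp (- (1 / d) * y) * indicator {0<..} y)" for y
  proof (cases "0 < y \<and> y \<le> d")
    case True
    have "1 \<le> exp (1 - y / d)"
      using True d by simp
    also have "\<dots> = exp 1 * exp (- (1 / d) * y)"
      by (simp flip: exp_add)
    finally have "y powr (- b) * 1 \<le> y powr (- b) * (exp 1 * exp (- (1 / d) * y))"
      by (intro mult_left_mono) auto
    then show ?thesis
      using True by (simp add: mult_ac)
  qed (auto simp: indicator_def)
  show 1: "integrable lborel (\<lambda>y. y powr (- b) * indicator {0<..d} y)"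
    using h le by (intro Bochner_Integration.integrable_bound[OF integrable.intros[OF h]]) (auto simp: abs_mult)
  have "(\<integral>y. y powr (- b) * indicator {0<..d} y \<partial>lborel) \<le> exp 1 * (Gamma (1 - b) / (1 / d) powr (1 - b))"
    unfolding has_bochner_integral_integral_eq[OF h, symmetric]
    using 1 le h by (intro integral_mono) (auto simp: has_bochner_integral_iff)
  also have "\<dots> = exp 1 * Gamma (1 - b) * d powr (1 - b)"
    using d by (simp add: powr_divide)
  finally show "(\<integral>y. y powr (- b) * indicator {0<..d} y \<partial>lborel) \<le> exp 1 * Gamma (1 - b) * d powr (1 - b)" .
qed

text \<open>The integral is cut at y = x/2 into \<open>N\<close> (small y, \<open>f\<close>
  evaluated far out) and \<open>R\<close> (large y, \<kappa> evaluated far out). After scaling by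
  x^b the part \<open>R\<close> gives the limit and \<open>N\<close> vanishes, once x^(1+b) f(x) is
  known to be bounded.\<close>

lemma Volterra_asymptotics:
  fixes f :: "real \<Rightarrow> real" and a b M :: real
  defines "\<kappa> \<equiv> \<lambda>y. a * (y powr (- b) * indicator {0<..} y)"
  assumes a: "0 < a" and b: "0 < b" "b < 1"
    and f: "continuous_on UNIV f" and f0: "\<And>x. 0 \<le> f x" "\<And>x. x < 0 \<Longrightarrow> f x = 0"
    and int: "\<And>x. integrable lborel (\<lambda>y. \<kappa> y * f (x - y))"
    and eq: "\<And>x. x * f x = (\<integral>y. \<kappa> y * f (x - y) \<partial>lborel)"
    and M: "has_bochner_integral lborel f M"
  shows "((\<lambda>x. x powr (1 + b) * f x) \<longlongrightarrow> a * M) at_top"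
proof -
  have [measurable]: "f \<in> borel_measurable borel"
    using f by (rule borel_measurable_continuous_onI)
  have [measurable]: "\<kappa> \<in> borel_measurable borel" unfolding \<kappa>_def by measurable
  have \<kappa>0: "0 \<le> \<kappa> y" for y using a by (simp add: \<kappa>_def)
  have fi: "integrable lborel f" and M_eq: "(\<integral>x. f x \<partial>lborel) = M"
    using M by (auto simp: has_bochner_integral_iff)
  have fshift: "integrable lborel (\<lambda>y. f (x - y))" "(\<integral>y. f (x - y) \<partial>lborel) = M" for x
    using lborel_integrable_real_affine[OF fi, of "-1" x] lborel_integral_real_affine[of "-1" f x] M_eq by simp_all
  define A where "A = a * (exp 1 * Gamma (1 - b))"
  have A0: "0 \<le> A" using a b by (simp add: A_def Gamma_real_pos less_imp_le)
  define N where "N x = (\<integral>y. \<kappa> y * indicator {..x / 2} y * f (x - y) \<partial>lborel)" for x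
  define R where "R x = (\<integral>y. \<kappa> y * indicator {x / 2<..} y * f (x - y) \<partial>lborel)" for x
  have intN: "integrable lborel (\<lambda>y. \<kappa> y * indicator {..x / 2} y * f (x - y))" for x
    by (rule Bochner_Integration.integrable_bound[OF int[of x]]) (auto simp: indicator_def)
  have intR: "integrable lborel (\<lambda>y. \<kappa> y * indicator {x / 2<..} y * f (x - y))" for x
    by (rule Bochner_Integration.integrable_bound[OF int[of x]]) (auto simp: indicator_def)
  have split: "x * f x = N x + R x" for x
    unfolding eq N_def R_def
    by (subst Bochner_Integration.integral_add[OF intN intR, symmetric])
       (intro Bochner_Integration.integral_cong, auto simp: indicator_def)
  have N0: "0 \<le> N x" for x
    unfolding N_def using \<kappa>0 f0 by (intro Bochner_Integration.integral_nonneg) auto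
  \<comment> \<open>The hypothesis on \<open>f\<close> is confined to [x/2, x], so it can be used
    with K = \<open>h x\<close> before any global bound exists. The exponent is - (1 + b) from
    \<open>f\<close> plus 1 - b from integrating y^(-b) over (0, x/2].\<close>
  have near: "N x \<le> K * A * (x / 2) powr (- (2 * b))"
    if x: "0 < x" and K: "0 \<le> K" "\<And>u. x / 2 \<le> u \<Longrightarrow> u \<le> x \<Longrightarrow> f u \<le> K * u powr (- (1 + b))" for x K
  proof -
    define S where "S = K * (x / 2) powr (- (1 + b))"
    have S0: "0 \<le> S" using K by (simp add: S_def)
    have "N x \<le> (\<integral>y. S * a * (y powr (- b) * indicator {0<..x / 2} y) \<partial>lborel)"
      unfolding N_def
    proof (rule integral_mono[OF intN])
      show "integrable lborel (\<lambda>y. S * a * (y powr (- b) * indicator {0<..x / 2} y))"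
        using b x by (intro integrable_mult_right integrable_powr_truncated) auto
      fix y
      show "\<kappa> y * indicator {..x / 2} y * f (x - y) \<le> S * a * (y powr (- b) * indicator {0<..x / 2} y)"
      proof (cases "0 < y \<and> y \<le> x / 2")
        case True
        then have "f (x - y) \<le> K * (x - y) powr (- (1 + b))"
          by (intro K) (auto simp: field_simps)
        also have "\<dots> \<le> S"
          unfolding S_def using True x K b by (intro mult_left_mono powr_mono2') auto
        finally have "a * y powr (- b) * f (x - y) \<le> a * y powr (- b) * S"
          using a by (intro mult_left_mono) auto
        then show ?thesis
          using True by (simp add: \<kappa>_def mult_ac)
      qed (auto simp: \<kappa>_def)
    qed
    also have "\<dots> = S * a * (\<integral>y. y powr (- b) * indicator {0<..x / 2} y \<partial>lborel)"
      by (rule integral_mult_right_zero)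
    also have "\<dots> \<le> S * a * (exp 1 * Gamma (1 - b) * (x / 2) powr (1 - b))"
      using S0 a b x by (intro mult_left_mono integral_powr_truncated_le) auto
    also have "\<dots> = K * A * ((x / 2) powr (- (1 + b)) * (x / 2) powr (1 - b))"
      by (simp add: S_def A_def mult_ac)
    also have "(x / 2) powr (- (1 + b)) * (x / 2) powr (1 - b) = (x / 2) powr (- (2 * b))"
      using x by (simp flip: powr_add)
    finally show ?thesis .
  qed
  have far: "R x \<le> a * (x / 2) powr (- b) * M" if x: "0 < x" for x
  proof -
    have "R x \<le> (\<integral>y. a * (x / 2) powr (- b) * f (x - y) \<partial>lborel)"
      unfolding R_def
    proof (rule integral_mono[OF intR])
      show "integrable lborel (\<lambda>y. a * (x / 2) powr (- b) * f (x - y))"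
        using fshift by simp
      fix y
      show "\<kappa> y * indicator {x / 2<..} y * f (x - y) \<le> a * (x / 2) powr (- b) * f (x - y)"
      proof (cases "x / 2 < y")
        case True
        then have "y powr (- b) \<le> (x / 2) powr (- b)"
          using x b by (intro powr_mono2') auto
        then have "a * y powr (- b) * f (x - y) \<le> a * (x / 2) powr (- b) * f (x - y)"
          using a f0 by (intro mult_right_mono mult_left_mono) auto
        then show ?thesis using True x by (simp add: \<kappa>_def)
      qed (use a f0 in auto)
    qed
    then show ?thesis using fshift by simp
  qed
  define h where "h x = x powr (1 + b) * f x" for x
  have h_f: "f u = h u * u powr (- (1 + b))" if "0 < u" for u
    using that powr_minus[of u "1 + b"] by (simp add: h_def)
  have h_split: "h x = x powr b * (N x + R x)" if "0 < x" for x
    using that by (simp add: h_def powr_add mult.assoc flip: split)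
  have x2: "x powr b * (x / 2) powr (- b) = 2 powr b" if "0 < x" for x
    using that by (simp add: powr_minus powr_divide field_simps)
  have h_near: "x powr b * N x \<le> 2 powr b * K * A * (x / 2) powr (- b)"
    if x: "0 < x" and K: "0 \<le> K" "\<And>u. x / 2 \<le> u \<Longrightarrow> u \<le> x \<Longrightarrow> f u \<le> K * u powr (- (1 + b))" for x K
  proof -
    have "x powr b * N x \<le> x powr b * (K * A * (x / 2) powr (- (2 * b)))"
      using near[OF that] by (intro mult_left_mono) auto
    also have "(x / 2) powr (- (2 * b)) = (x / 2) powr (- b) * (x / 2) powr (- b)"
      using x by (simp flip: powr_add)
    also have "x powr b * (K * A * \<dots>) = (x powr b * (x / 2) powr (- b)) * (K * A * (x / 2) powr (- b))"
      by (simp only: mult_ac)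
    finally show ?thesis using x by (simp only: x2 mult_ac)
  qed
  have lim0: "((\<lambda>x. 2 powr b * K * A * (x / 2) powr (- b)) \<longlongrightarrow> 0) at_top" for K
  proof -
    have "filterlim (\<lambda>x::real. x * (1 / 2)) at_top at_top"
      by (rule filterlim_at_top_mult_tendsto_pos[OF tendsto_const _ filterlim_ident]) simp
    then have "((\<lambda>x. (x / 2) powr (- b)) \<longlongrightarrow> 0) at_top"
      using b by (intro tendsto_neg_powr) auto
    from tendsto_mult_left[OF this, of "2 powr b * K * A"] show ?thesis by simp
  qed
  \<comment> \<open>At a maximum point x of \<open>h\<close> on [1, X], \<open>h_near\<close>
    applies with K = \<open>h x\<close>. For large x its coefficient is below 1/2, so half of
    \<open>h x\<close> is absorbed and h x \<le> 2 (2^b a M), independently of X.\<close>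
  obtain K where K: "0 \<le> K" "\<And>u. 1 \<le> u \<Longrightarrow> f u \<le> K * u powr (- (1 + b))"
  proof -
    have "\<forall>\<^sub>F x in at_top. 2 powr b * 1 * A * (x / 2) powr (- b) < 1 / 2"
      using order_tendstoD(2)[OF lim0[of 1], of "1 / 2"] by simp
    then obtain x0 where x0: "\<And>x. x0 \<le> x \<Longrightarrow> 2 powr b * A * (x / 2) powr (- b) < 1 / 2"
      by (auto simp: eventually_at_top_linorder)
    \<comment> \<open>Beyond 2 the window [x/2, x] stays inside [1, X], where \<open>h x\<close> is
      the maximum; up to \<open>x1\<close> compactness provides the bound \<open>B\<close>.\<close>
    define x1 where "x1 = max 2 x0"
    have cont: "continuous_on {1..X} h" for X
      unfolding h_def by (intro continuous_intros continuous_on_subset[OF f]) auto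
    obtain B where B: "\<And>x. 1 \<le> x \<Longrightarrow> x \<le> x1 \<Longrightarrow> h x \<le> B"
      using continuous_attains_sup[of "{1..x1}" h] cont[of x1] by (force simp: x1_def)
    define K where "K = max B (2 * (2 powr b * a * M))"
    have hK: "h X \<le> K" if X: "1 \<le> X" for X
    proof -
      obtain x where x: "1 \<le> x" "x \<le> X" "\<And>y. 1 \<le> y \<Longrightarrow> y \<le> X \<Longrightarrow> h y \<le> h x"
        using continuous_attains_sup[of "{1..X}" h] cont[of X] X by force
      have "h x \<le> K"
      proof (cases "x \<le> x1")
        case True
        then show ?thesis using B[of x] x by (simp add: K_def)
      next
        case False
        have hx0: "0 \<le> h x" using f0 by (simp add: h_def)
        have x': "0 < x" "2 < x" "x0 \<le> x" using False by (auto simp: x1_def)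
        have "x powr b * N x \<le> 2 powr b * h x * A * (x / 2) powr (- b)"
        proof (rule h_near[OF x'(1) hx0])
          fix u assume u: "x / 2 \<le> u" "u \<le> x"
          then have "h u \<le> h x" using x x' by (intro x(3)) auto
          then show "f u \<le> h x * u powr (- (1 + b))"
            using h_f[of u] u x' by (simp add: mult_right_mono)
        qed
        also have "\<dots> = h x * (2 powr b * A * (x / 2) powr (- b))"
          by (simp only: mult_ac)
        also have "\<dots> \<le> h x * (1 / 2)"
          using x0[OF x'(3)] hx0 by (intro mult_left_mono) auto
        finally have "x powr b * N x \<le> h x / 2" by simp
        moreover have "x powr b * R x \<le> 2 powr b * a * M"
        proof -
          have "x powr b * R x \<le> x powr b * (a * (x / 2) powr (- b) * M)"
            using far[OF x'(1)] by (intro mult_left_mono) auto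
          also have "\<dots> = (x powr b * (x / 2) powr (- b)) * a * M"
            by (simp only: mult_ac)
          finally show ?thesis using x2[OF x'(1)] by simp
        qed
        ultimately have "h x \<le> h x / 2 + 2 powr b * a * M"
          using h_split[OF x'(1)] unfolding distrib_left by linarith
        then show ?thesis by (simp add: K_def)
      qed
      then show ?thesis using x(3)[of X] X by linarith
    qed
    show ?thesis
    proof (rule that)
      have "0 \<le> h 1" using f0 by (simp add: h_def)
      then show "0 \<le> K" using hK[of 1] by simp
      show "f u \<le> K * u powr (- (1 + b))" if "1 \<le> u" for u
        using h_f[of u] hK[of u] that by (simp add: mult_right_mono)
    qed
  qed
  have limN: "((\<lambda>x. x powr b * N x) \<longlongrightarrow> 0) at_top"
  proof (rule tendsto_sandwich[OF _ _ tendsto_const lim0[of K]])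
    show "\<forall>\<^sub>F x in at_top. 0 \<le> x powr b * N x"
      using N0 by (intro always_eventually) auto
    show "\<forall>\<^sub>F x in at_top. x powr b * N x \<le> 2 powr b * K * A * (x / 2) powr (- b)"
      using eventually_ge_at_top[of "2 :: real"]
      by eventually_elim (intro h_near K, auto)
  qed
  \<comment> \<open>Substituting u = x - y moves the parameter x from \<open>f\<close> into the
    kernel, so that a multiple of \<open>f\<close> can serve as majorant.\<close>
  have R_eq: "x powr b * R x = (\<integral>u. x powr b * (\<kappa> (x - u) * indicator {..<x / 2} u * f u) \<partial>lborel)" for x
  proof -
    have "R x = (\<integral>u. \<kappa> (x - u) * indicator {x / 2<..} (x - u) * f u \<partial>lborel)"
      unfolding R_def by (subst lborel_integral_real_affine[where c = "-1" and t = x]) simp_all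
    also have "\<dots> = (\<integral>u. \<kappa> (x - u) * indicator {..<x / 2} u * f u \<partial>lborel)"
      by (intro Bochner_Integration.integral_cong) (auto simp: indicator_def)
    finally show ?thesis by simp
  qed
  have limR: "((\<lambda>x. x powr b * R x) \<longlongrightarrow> (\<integral>u. a * f u \<partial>lborel)) at_top"
    unfolding R_eq
  proof (rule integral_dominated_convergence_at_top[where w = "\<lambda>u. 2 powr b * a * f u"])
    \<comment> \<open>The quotient x / (x - u) is at most 2 for 0 \<le> u < x/2, whence the 2^b in
      the majorant, and it tends to 1 for fixed u.\<close>
    have ratio: "x powr b * \<kappa> (x - u) = a * (x / (x - u)) powr b" if "0 < x" "u < x" for x u
      using that by (simp add: \<kappa>_def powr_minus powr_divide field_simps)
    show "\<forall>\<^sub>F x in at_top. AE u in lborel. norm (x powr b * (\<kappa> (x - u) * indicator {..<x / 2} u * f u)) \<le> 2 powr b * a * f u"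
      using eventually_gt_at_top[of "0 :: real"]
    proof eventually_elim
      case (elim x)
      show ?case
      proof (rule AE_I2)
        fix u
        show "norm (x powr b * (\<kappa> (x - u) * indicator {..<x / 2} u * f u)) \<le> 2 powr b * a * f u"
        proof (cases "0 \<le> u \<and> u < x / 2")
          case True
          have *: "(x / (x - u)) powr b \<le> 2 powr b"
            using True elim b by (intro powr_mono2) (auto simp: field_simps)
          have "norm (x powr b * (\<kappa> (x - u) * indicator {..<x / 2} u * f u))
              = x powr b * (\<kappa> (x - u) * indicator {..<x / 2} u * f u)"
            unfolding real_norm_def by (intro abs_of_nonneg mult_nonneg_nonneg \<kappa>0 f0) auto
          also have "\<dots> = a * (x / (x - u)) powr b * f u"
            using True elim ratio[of x u] by (simp flip: mult.assoc)
          also have "\<dots> \<le> a * 2 powr b * f u"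
            using a f0 * by (intro mult_right_mono mult_left_mono) auto
          finally show ?thesis
            by (simp only: mult_ac)
        next
          case False
          then show ?thesis
            using a f0[of u] by (cases "u < 0") auto
        qed
      qed
    qed
    show "AE u in lborel. ((\<lambda>x. x powr b * (\<kappa> (x - u) * indicator {..<x / 2} u * f u)) \<longlongrightarrow> a * f u) at_top"
    proof (rule AE_I2)
      fix u :: real
      have "((\<lambda>x. x / (x - u)) \<longlongrightarrow> 1) at_top"
      proof -
        have "((\<lambda>x. inverse (1 - u * inverse x)) \<longlongrightarrow> inverse (1 - u * 0)) at_top"
          by (intro tendsto_intros tendsto_inverse_0_at_top filterlim_ident) auto
        moreover have "\<forall>\<^sub>F x in at_top. inverse (1 - u * inverse x) = x / (x - u)"
          using eventually_gt_at_top[of "max 0 u"] by eventually_elim (simp add: field_simps)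
        ultimately show ?thesis by (simp add: tendsto_cong)
      qed
      then have "((\<lambda>x. a * (x / (x - u)) powr b * f u) \<longlongrightarrow> a * 1 powr b * f u) at_top"
        by (intro tendsto_intros) auto
      moreover have "\<forall>\<^sub>F x in at_top. a * (x / (x - u)) powr b * f u = x powr b * (\<kappa> (x - u) * indicator {..<x / 2} u * f u)"
        using eventually_gt_at_top[of "max 0 (max u (2 * u))"]
        by eventually_elim (use ratio[of _ u] in \<open>simp flip: mult.assoc\<close>)
      ultimately show "((\<lambda>x. x powr b * (\<kappa> (x - u) * indicator {..<x / 2} u * f u)) \<longlongrightarrow> a * f u) at_top"
        by (simp add: tendsto_cong)
    qed
  qed (use fi in auto)
  from tendsto_add[OF limN limR] have "((\<lambda>x. x powr b * (N x + R x)) \<longlongrightarrow> a * M) at_top"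
    by (simp add: distrib_left M_eq)
  moreover have "\<forall>\<^sub>F x in at_top. x powr b * (N x + R x) = x powr (1 + b) * f x"
    using eventually_gt_at_top[of "0 :: real"] by eventually_elim (use h_split in \<open>simp add: h_def\<close>)
  ultimately show ?thesis
    by (simp add: tendsto_cong)
qed

section \<open>Convolution on the half-line\<close>

text \<open>No global bound on \<open>g\<close> is assumed. For x \<le> X the integrand involves
  \<open>g\<close> only on the compact interval [0, X], as \<open>k\<close> vanishes for y \<le> 0
  and \<open>g\<close> on the negatives; a multiple of |k| is then a majorant locally uniform in
  x.\<close>

lemma
  fixes k g :: "real \<Rightarrow> real"
  assumes k: "integrable lborel k" "\<And>y. y \<le> 0 \<Longrightarrow> k y = 0"
    and g: "continuous_on UNIV g" "\<And>x. x < 0 \<Longrightarrow> g x = 0"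
  shows integrable_half_line_convolution: "integrable lborel (\<lambda>y. k y * g (x - y))"
    and continuous_on_half_line_convolution: "continuous_on UNIV (\<lambda>x. \<integral>y. k y * g (x - y) \<partial>lborel)"
proof -
  have [measurable]: "g \<in> borel_measurable borel" "k \<in> borel_measurable borel"
    using g k by (auto intro: borel_measurable_continuous_onI)
  have bdd: "\<exists>B. \<forall>x\<le>X. \<forall>y. norm (k y * g (x - y)) \<le> B * \<bar>k y\<bar>" for X
  proof -
    have "compact (g ` {0..X})"
      using g by (intro compact_continuous_image continuous_on_subset[OF g(1)]) auto
    then have "bounded (g ` {0..X})"
      by (rule compact_imp_bounded)
    then obtain B where B: "B > 0" "\<And>u. 0 \<le> u \<Longrightarrow> u \<le> X \<Longrightarrow> \<bar>g u\<bar> \<le> B"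
      unfolding bounded_pos by auto
    have "norm (k y * g (x - y)) \<le> B * \<bar>k y\<bar>" if "x \<le> X" for x y
    proof (cases "0 < y \<and> 0 \<le> x - y")
      case True
      then have "\<bar>g (x - y)\<bar> \<le> B" using that by (intro B) auto
      then show ?thesis by (simp add: abs_mult mult.commute[of B] mult_left_mono)
    next
      case False
      then have "k y = 0 \<or> g (x - y) = 0" using k(2)[of y] g(2)[of "x - y"] by linarith
      then show ?thesis using B(1) by auto
    qed
    then show ?thesis by blast
  qed
  show "integrable lborel (\<lambda>y. k y * g (x - y))"
  proof -
    obtain B where B: "\<And>y. norm (k y * g (x - y)) \<le> B * \<bar>k y\<bar>"
      using bdd[of x] by auto
    show ?thesis
    proof (rule Bochner_Integration.integrable_bound)
      show "integrable lborel (\<lambda>y. B * \<bar>k y\<bar>)" using k by simp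
      show "AE y in lborel. norm (k y * g (x - y)) \<le> norm (B * \<bar>k y\<bar>)"
        by (intro AE_I2 order.trans[OF B]) simp
    qed measurable
  qed
  show "continuous_on UNIV (\<lambda>x. \<integral>y. k y * g (x - y) \<partial>lborel)"
    unfolding continuous_on_sequentially o_def
  proof safe
    fix q :: "nat \<Rightarrow> real" and x assume q: "q \<longlonglongrightarrow> x"
    then have "Bseq q" by (rule convergentI[THEN convergent_imp_Bseq])
    then obtain X where X: "\<And>n. q n \<le> X"
      using Bseq_def abs_le_D1 by (metis real_norm_def)
    obtain B where B: "\<And>n y. norm (k y * g (q n - y)) \<le> B * \<bar>k y\<bar>"
      using bdd[of X] X by blast
    show "(\<lambda>n. \<integral>y. k y * g (q n - y) \<partial>lborel) \<longlonglongrightarrow> (\<integral>y. k y * g (x - y) \<partial>lborel)"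
    proof (rule integral_dominated_convergence)
      show "integrable lborel (\<lambda>y. B * \<bar>k y\<bar>)" using k by simp
      show "AE y in lborel. norm (k y * g (q n - y)) \<le> B * \<bar>k y\<bar>" for n
        by (intro AE_I2 B)
      have "isCont g u" for u
        using g(1) by (simp add: continuous_on_eq_continuous_at)
      then show "AE y in lborel. (\<lambda>n. k y * g (q n - y)) \<longlonglongrightarrow> k y * g (x - y)"
        by (intro AE_I2 tendsto_intros q isCont_tendsto_compose[where g = g])
    qed measurable
  qed
qed

section \<open>From the tempered stable law to the Volterra equation and its asymptotics\<close>

theorem theorem7p7:
  fixes \<alpha> \<beta> l :: real and \<eta> :: "real measure" and g :: "real \<Rightarrow> real"
  assumes "0 < \<alpha>" and "0 < l" and "0 < \<beta>" and "\<beta> < 1"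
    and "is_TS \<alpha> \<beta> l \<eta>"
    and "is_continuous_density \<eta> g"
  shows "g \<sim>[at_top]
    (\<lambda>x. \<alpha> * exp (- \<alpha> * Gamma (- \<beta>) * l powr \<beta>) * (exp (- l * x) / x powr (1 + \<beta>)))"
proof -
  have g: "continuous_on UNIV g" "\<And>x. 0 \<le> g x" and \<eta>: "\<eta> = density lborel (\<lambda>x. ennreal (g x))"
    using assms(6) by (auto simp: is_continuous_density_def)
  have [measurable]: "g \<in> borel_measurable borel"
    using g(1) by (rule borel_measurable_continuous_onI)
  interpret \<eta>: real_distribution \<eta>
    using assms(5) by (simp add: is_TS_def)
  define w where "w x = \<alpha> / x powr (1 + \<beta>) * exp (- l * x) * indicator {0<..} x" for x
  \<comment> \<open>\<open>k\<close> is the density of x F(dx); the exponent is written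
    \<open>1 - \<beta> - 1\<close> to match the Gamma integral.\<close>
  define k where "k y = \<alpha> * (y powr (1 - \<beta> - 1) * exp (- l * y) * indicator {0<..} y)" for y
  have xw: "y * w y = k y" for y
    by (cases "0 < y") (simp_all add: w_def k_def powr_add powr_minus field_simps)
  have ki: "integrable lborel k"
    unfolding k_def[abs_def] using assms
    by (intro integrable.intros[OF has_bochner_integral_mult_right[OF has_bochner_integral_powr_exp]]) auto
  \<comment> \<open>This is the density of x^2 F(dx), again a Gamma integrand, now with parameter 2
    - \<beta>.\<close>
  have k2i: "integrable lborel (\<lambda>y. \<alpha> * (y powr (2 - \<beta> - 1) * exp (- l * y) * indicator {0<..} y))"
    using assms
    by (intro integrable.intros[OF has_bochner_integral_mult_right[OF has_bochner_integral_powr_exp]]) auto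
  have ae: "AE x in lborel. x * g x = (\<integral>y. k y * g (x - y) \<partial>lborel)"
    unfolding xw[symmetric]
  proof (rule size_bias_identity)
    show "w \<in> borel_measurable borel" unfolding w_def by measurable
    show "0 \<le> w x" "x < 0 \<Longrightarrow> w x = 0" for x using assms by (auto simp: w_def)
    show "integrable lborel (\<lambda>x. x * w x)" unfolding xw by (rule ki)
    have "x\<^sup>2 * w x = \<alpha> * (x powr (2 - \<beta> - 1) * exp (- l * x) * indicator {0<..} x)" for x
    proof (cases "0 < x")
      case True
      have "x * x powr (1 - \<beta> - 1) = x powr 1 * x powr (1 - \<beta> - 1)" using True by simp
      also have "\<dots> = x powr (2 - \<beta> - 1)" unfolding powr_add[symmetric] by simp
      finally have "x * x powr (1 - \<beta> - 1) = x powr (2 - \<beta> - 1)" .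
      then show ?thesis
        unfolding power2_eq_square mult.assoc xw k_def by (simp add: mult_ac)
    qed (simp add: w_def)
    then show "integrable lborel (\<lambda>x. x\<^sup>2 * w x)" using k2i by simp
    show "real_distribution (density lborel (\<lambda>x. ennreal (g x)))"
      using \<eta>.real_distribution_axioms by (simp add: \<eta>)
    show "char (density lborel (\<lambda>x. ennreal (g x))) z = exp (CLINT x|density lborel (\<lambda>x. ennreal (w x)). iexp (z * x) - 1)" for z
      using assms(5) by (simp add: is_TS_def TS_Levy_measure_def \<eta> w_def)
  qed (use g in auto)
  have k0: "0 \<le> k y" "y \<le> 0 \<Longrightarrow> k y = 0" for y using assms by (auto simp: k_def)
  \<comment> \<open>The convolution of \<open>k\<close> and \<open>g\<close> is nonnegative, so x
    g(x) \<ge> 0 almost everywhere; for x < 0 this leaves only g(x) = 0.\<close>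
  have g_neg: "g x = 0" if "x < 0" for x
  proof (rule continuous_eq_if_AE_eq[where S = "{..<0}" and f = g and g = "\<lambda>_. 0"])
    show "AE x in lborel. x \<in> {..<0} \<longrightarrow> g x = 0"
      using ae
    proof eventually_elim
      case (elim x)
      have "0 \<le> x * g x"
        unfolding elim using k0 g by (intro Bochner_Integration.integral_nonneg) auto
      then show ?case using g(2)[of x] by (auto simp: zero_le_mult_iff)
    qed
  qed (use that g in \<open>auto intro: continuous_on_subset\<close>)
  \<comment> \<open>Both sides are continuous, so the identity holds everywhere; continuity of the
    convolution relies on \<open>g_neg\<close>.\<close>
  have eq: "x * g x = (\<integral>y. k y * g (x - y) \<partial>lborel)" for x
    by (rule continuous_eq_if_AE_eq[where S = UNIV and f = "\<lambda>x. x * g x"])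
       (use ae in \<open>auto intro!: continuous_intros g continuous_on_half_line_convolution ki k0 g_neg\<close>)
  define f where "f x = exp (l * x) * g x" for x
  define \<kappa> where "\<kappa> y = \<alpha> * (y powr (- \<beta>) * indicator {0<..} y)" for y :: real
  have \<kappa>f: "\<kappa> y * f (x - y) = exp (l * x) * (k y * g (x - y))" for x y
  proof -
    have "exp (l * (x - y)) = exp (l * x) * exp (- l * y)"
      by (simp add: algebra_simps flip: exp_add)
    then show ?thesis by (simp add: \<kappa>_def f_def k_def)
  qed
  have f: "continuous_on UNIV f" "\<And>x. 0 \<le> f x" "\<And>x. x < 0 \<Longrightarrow> f x = 0"
    unfolding f_def using g by (auto intro!: continuous_intros simp: g_neg)
  have \<kappa>i: "integrable lborel (\<lambda>y. \<kappa> y * f (x - y))" for x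
    unfolding \<kappa>f by (intro integrable_mult_right integrable_half_line_convolution ki k0 g g_neg)
  have f_eq: "x * f x = (\<integral>y. \<kappa> y * f (x - y) \<partial>lborel)" for x
  proof -
    have "x * f x = exp (l * x) * (x * g x)" by (simp add: f_def)
    then show ?thesis by (simp only: \<kappa>f integral_mult_right_zero eq)
  qed
  \<comment> \<open>The total mass of \<eta> is the Laplace transform of \<open>f\<close> at p =
    l.\<close>
  have one: "has_bochner_integral lborel (\<lambda>x. exp (- l * x) * f x) 1"
  proof (rule has_bochner_integral_nn_integral)
    have "(\<integral>\<^sup>+x. ennreal (exp (- l * x) * f x) \<partial>lborel) = (\<integral>\<^sup>+x. ennreal (g x) \<partial>lborel)"
      by (simp add: f_def mult.assoc[symmetric] flip: exp_add)
    also have "\<dots> = emeasure \<eta> (space \<eta>)"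
      unfolding \<eta> by (subst emeasure_density) auto
    also have "\<dots> = 1" by (rule \<eta>.emeasure_space_1)
    finally show "(\<integral>\<^sup>+x. ennreal (exp (- l * x) * f x) \<partial>lborel) = ennreal 1" by simp
  qed (use f in \<open>auto simp: f_def\<close>)
  define M where "M = exp (- \<alpha> * Gamma (- \<beta>) * l powr \<beta>)"
  \<comment> \<open>-\<beta> is not a pole, so \<Gamma>(1 - \<beta>) = - \<beta> \<Gamma>(-\<beta>),
    which brings the constant into the stated form.\<close>
  have "- \<beta> \<notin> \<int>\<^sub>\<le>\<^sub>0"
  proof
    assume "- \<beta> \<in> \<int>\<^sub>\<le>\<^sub>0"
    then obtain n where "- \<beta> = - real n" by (auto elim: nonpos_Ints_cases')
    then show False using assms by simp
  qed
  from Gamma_plus1[OF this] have "\<alpha> * Gamma (1 - \<beta>) / \<beta> = - \<alpha> * Gamma (- \<beta>)"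
    using assms by (simp add: add.commute)
  then have "has_bochner_integral lborel f M"
    unfolding M_def using integral_if_Volterra[of \<alpha> \<beta> l f, folded \<kappa>_def] assms f \<kappa>i f_eq one
    by (simp add: borel_measurable_continuous_onI)
  then have lim: "((\<lambda>x. x powr (1 + \<beta>) * f x) \<longlongrightarrow> \<alpha> * M) at_top"
    using Volterra_asymptotics[of \<alpha> \<beta> f M, folded \<kappa>_def] assms f \<kappa>i f_eq by simp
  have "M > 0" by (simp add: M_def)
  with tendsto_divide[OF lim tendsto_const[of "\<alpha> * M"]] assms
  have "((\<lambda>x. x powr (1 + \<beta>) * f x / (\<alpha> * M)) \<longlongrightarrow> 1) at_top" by simp
  moreover have "\<forall>\<^sub>F x in at_top. x powr (1 + \<beta>) * f x / (\<alpha> * M) = g x / (\<alpha> * M * (exp (- l * x) / x powr (1 + \<beta>)))"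
    using eventually_gt_at_top[of "0 :: real"]
    by eventually_elim (simp add: f_def exp_minus field_simps)
  ultimately have "((\<lambda>x. g x / (\<alpha> * M * (exp (- l * x) / x powr (1 + \<beta>)))) \<longlongrightarrow> 1) at_top"
    by (rule Lim_transform_eventually)
  then show ?thesis
    unfolding M_def by (rule asymp_equivI')
qed

end
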